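(* Consider the system $$\dot x = y,\qquad \dot y = -x^3+\delta x^2y+y^3,$$ with $\delta\in\mathbb{R}$. If $$0>\delta>-\frac{3\sqrt[3]{-9+6\sqrt3}}{\sqrt[3]{4}}\approx -2.1103,$$ then there exists a Poincaré–Bendixson region for the system bounded by the origin (which is stable) and a transversal hyperbola together with part of the equator of the Poincaré disk.
   Context: Write the system as $\dot x=P(x,y)$, $\dot y=Q(x,y)$. A hyperbola $H=\{f(x,y)=0\}$, with $f$ a real polynomial of degree 2, is transversal for the system if $\dot f:=P\,\partial f/\partial x+Q\,\partial f/\partial y$ satisfies either $\dot f\ge 0$ at all points of $H$ or $\dot f\le 0$ at all points of $H$, and $\dot f=0$ only at finitely many points of $H$. The Poincaré disk is the closed disk obtained by the Poincaré compactification: $\mathbb{R}^2$ is mapped to a hemisphere of $\mathbb{S}^2$ by $(x,y)\mapsto (x,y,1)/\sqrt{x^2+y^2+1}$, and the hemisphere together with its equator $\{Z=0\}$ is projected to a disk; the (suitably time-rescaled) polynomial flow extends to the equator, which is invariant. A Poincaré–Bendixson region is ordinarily a finite region between two transversal simple closed curves which contains no critical points and such that the flow crosses both curves towards the interior of the region (or, reversing time, both towards its exterior). Here the notion is used in the following extended sense: "a Poincaré–Bendixson region bounded by the origin and a transversal hyperbola $H$ together with part of the equator of the Poincaré disk" means that the origin is asymptotically stable; $H$ is a transversal hyperbola not passing through the origin; the region $R$ is the connected component of $\mathbb{R}^2\setminus H$ containing the origin, with the origin removed, and its boundary in the Poincaré disk consists of the origin, $H$ (both branches) and arcs of the equator;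 $R$ contains no critical points of the system; the flow crosses $H$ from $R$ to the outside of $R$ (consistently with the origin being an attractor); and the critical points of the extended flow on the equator lying in the closure of $R$ are neither sinks nor sources (i.e. neither attract nor repel all nearby orbits in the Poincaré disk). *)

theory Defs
  imports "HOL-Analysis.Analysis"
begin

type_synonym plane = "real \<times> real"
type_synonym space = "real \<times> real \<times> real"

definition system :: "real \<Rightarrow> plane \<Rightarrow> plane" where
  "system \<delta> = (\<lambda>(x, y). (y, - (x ^ 3) + \<delta> * x ^ 2 * y + y ^ 3))"


section \<open>Solutions and asymptotic stability\<close>

definition solves_on :: "('a::real_normed_vector \<Rightarrow> 'a) \<Rightarrow> (real \<Rightarrow> 'a) \<Rightarrow> real set \<Rightarrow> bool" where
  "solves_on F \<gamma> S \<longleftrightarrow> (\<forall>t\<in>S. (\<gamma> has_vector_derivative F (\<gamma> t)) (at t within S))"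

text \<open>Meant for locally Lipschitz \<open>F\<close>. The stability clause ranges over solutions on all intervals
  \<open>[0, T)\<close>, so it also covers solutions not known to exist for all positive times.\<close>

definition asymptotically_stable ::
  "('a::real_normed_vector \<Rightarrow> 'a) \<Rightarrow> 'a \<Rightarrow> bool" where
  "asymptotically_stable F p \<longleftrightarrow>
     F p = 0 \<and>
     (\<forall>\<epsilon>>0. \<exists>\<eta>>0. \<forall>T>0. \<forall>\<gamma>. solves_on F \<gamma> {0..<T} \<longrightarrow> dist (\<gamma> 0) p < \<eta> \<longrightarrow>
        (\<forall>t\<in>{0..<T}. dist (\<gamma> t) p < \<epsilon>)) \<and>
     (\<exists>\<eta>>0. \<forall>\<gamma>. solves_on F \<gamma> {0..} \<longrightarrow> dist (\<gamma> 0) p < \<eta> \<longrightarrow> (\<gamma> \<longlongrightarrow> p) at_top)"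


section \<open>Transversal hyperbolas\<close>

definition zero_locus :: "(plane \<Rightarrow> real) \<Rightarrow> plane set" where
  "zero_locus f = {p. f p = 0}"

text \<open>A real polynomial of degree 2 whose zero set is a (nondegenerate) hyperbola: the quadratic part
  is indefinite and the symmetric matrix of the conic is nonsingular, the latter excluding pairs
  of intersecting lines.\<close>

definition hyperbola_poly :: "(plane \<Rightarrow> real) \<Rightarrow> bool" where
  "hyperbola_poly f \<longleftrightarrow>
     (\<exists>a b c d e k.
        f = (\<lambda>(x, y). a * x ^ 2 + b * x * y + c * y ^ 2 + d * x + e * y + k) \<and>
        b ^ 2 - 4 * a * c > 0 \<and>
        det (vector [vector [a, b / 2, d / 2],
                     vector [b / 2, c, e / 2],
                     vector [d / 2, e / 2, k]] :: real ^ 3 ^ 3) \<noteq> 0)"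

definition orbital_deriv :: "(plane \<Rightarrow> plane) \<Rightarrow> (plane \<Rightarrow> real) \<Rightarrow> plane \<Rightarrow> real" where
  "orbital_deriv F f = (\<lambda>(x, y).
     fst (F (x, y)) * deriv (\<lambda>s. f (s, y)) x + snd (F (x, y)) * deriv (\<lambda>s. f (x, s)) y)"

definition transversal :: "(plane \<Rightarrow> plane) \<Rightarrow> (plane \<Rightarrow> real) \<Rightarrow> bool" where
  "transversal F f \<longleftrightarrow>
     ((\<forall>p\<in>zero_locus f. orbital_deriv F f p \<ge> 0) \<or>
      (\<forall>p\<in>zero_locus f. orbital_deriv F f p \<le> 0)) \<and>
     finite {p \<in> zero_locus f. orbital_deriv F f p = 0}"

text \<open>Every solution through a point of \<open>H\<close> is in \<open>R\<close> just before and outside \<open>R\<close>, off its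
  boundary, just after.\<close>

definition flow_exits_through :: "(plane \<Rightarrow> plane) \<Rightarrow> plane set \<Rightarrow> plane set \<Rightarrow> bool" where
  "flow_exits_through F R H \<longleftrightarrow>
     (\<forall>\<epsilon>>0. \<forall>\<gamma>. solves_on F \<gamma> {-\<epsilon><..<\<epsilon>} \<longrightarrow> \<gamma> 0 \<in> H \<longrightarrow>
        (\<forall>\<^sub>F t in at_left 0. \<gamma> t \<in> R) \<and> (\<forall>\<^sub>F t in at_right 0. \<gamma> t \<notin> closure R))"


section \<open>Poincare compactification\<close>

definition hemisphere :: "space set" where
  "hemisphere = {(X, Y, Z). X ^ 2 + Y ^ 2 + Z ^ 2 = 1 \<and> Z \<ge> 0}"

definition to_hemisphere :: "plane \<Rightarrow> space" where
  "to_hemisphere = (\<lambda>(x, y). (1 / sqrt (x ^ 2 + y ^ 2 + 1)) *\<^sub>R (x, y, 1))"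

definition disk_proj :: "space \<Rightarrow> plane" where
  "disk_proj = (\<lambda>(X, Y, Z). (X, Y))"

definition poincare_disk :: "plane set" where
  "poincare_disk = disk_proj ` hemisphere"

definition to_disk :: "plane \<Rightarrow> plane" where
  "to_disk p = disk_proj (to_hemisphere p)"

definition equator :: "plane set" where
  "equator = sphere 0 1"

text \<open>For a polynomial \<open>g\<close> of degree at most \<open>n\<close>, the homogeneous polynomial
  \<open>Z\<^sup>n g(X/Z, Y/Z)\<close>; the limit supplies its values at \<open>Z = 0\<close>.\<close>

definition homogenize :: "nat \<Rightarrow> (plane \<Rightarrow> real) \<Rightarrow> space \<Rightarrow> real" where
  "homogenize n g = (\<lambda>(X, Y, Z). Lim (at Z) (\<lambda>z. z ^ n * g (X / z, Y / z)))"

text \<open>Push-forward of \<open>F\<close>, a polynomial vector field of degree \<open>n\<close>, under \<open>to_hemisphere\<close>,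
  multiplied by \<open>Z\<^bsup>n - 1\<^esup>\<close> (a time rescaling), which extends it to the equator \<open>Z = 0\<close>
  (see \<open>compactified_field_pushforward\<close>).\<close>

definition compactified_field :: "nat \<Rightarrow> (plane \<Rightarrow> plane) \<Rightarrow> space \<Rightarrow> space" where
  "compactified_field n F = (\<lambda>(X, Y, Z).
     let P = homogenize n (\<lambda>p. fst (F p)) (X, Y, Z);
         Q = homogenize n (\<lambda>p. snd (F p)) (X, Y, Z);
         r = X * P + Y * Q
     in (P - X * r, Q - Y * r, - Z * r))"

definition disk_orbit :: "nat \<Rightarrow> (plane \<Rightarrow> plane) \<Rightarrow> (real \<Rightarrow> plane) \<Rightarrow> real set \<Rightarrow> bool" where
  "disk_orbit n F \<phi> S \<longleftrightarrow>
     (\<exists>\<gamma>. solves_on (compactified_field n F) \<gamma> S \<and> \<gamma> ` S \<subseteq> hemisphere \<and>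
          \<phi> = (\<lambda>t. disk_proj (\<gamma> t)))"

definition critical_at_infinity :: "nat \<Rightarrow> (plane \<Rightarrow> plane) \<Rightarrow> plane \<Rightarrow> bool" where
  "critical_at_infinity n F p \<longleftrightarrow>
     p \<in> equator \<and> compactified_field n F (fst p, snd p, 0) = 0"

text \<open>The hemisphere is compact and invariant, so orbits are defined for all times. Lyapunov
  stability is not required, which only makes ``neither sink nor source'' more restrictive.\<close>

definition disk_sink :: "nat \<Rightarrow> (plane \<Rightarrow> plane) \<Rightarrow> plane \<Rightarrow> bool" where
  "disk_sink n F p \<longleftrightarrow>
     (\<exists>U. open U \<and> p \<in> U \<and>
        (\<forall>\<phi>. disk_orbit n F \<phi> {0..} \<longrightarrow> \<phi> 0 \<in> U \<longrightarrow> (\<phi> \<longlongrightarrow> p) at_top))"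

definition disk_source :: "nat \<Rightarrow> (plane \<Rightarrow> plane) \<Rightarrow> plane \<Rightarrow> bool" where
  "disk_source n F p \<longleftrightarrow>
     (\<exists>U. open U \<and> p \<in> U \<and>
        (\<forall>\<phi>. disk_orbit n F \<phi> {..0} \<longrightarrow> \<phi> 0 \<in> U \<longrightarrow> (\<phi> \<longlongrightarrow> p) at_bot))"


section \<open>Extended Poincare--Bendixson regions\<close>

text \<open>\<open>R\<close> is bounded by the origin, the transversal hyperbola \<open>f = 0\<close> and part of the
  equator of the Poincare disk; \<open>n\<close> is the degree of \<open>F\<close>.\<close>

definition poincare_bendixson_region ::
  "nat \<Rightarrow> (plane \<Rightarrow> plane) \<Rightarrow> (plane \<Rightarrow> real) \<Rightarrow> plane set \<Rightarrow> bool" where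
  "poincare_bendixson_region n F f R \<longleftrightarrow>
     asymptotically_stable F 0 \<and>
     hyperbola_poly f \<and> transversal F f \<and> 0 \<notin> zero_locus f \<and>
     R = connected_component_set (- zero_locus f) 0 - {0} \<and>
     (\<exists>\<A>. finite \<A> \<and> \<A> \<noteq> {} \<and>
        (\<forall>A\<in>\<A>. \<exists>g. arc g \<and> path_image g \<subseteq> equator \<and> A = path_image g) \<and>
        top_of_set poincare_disk frontier_of (to_disk ` R) =
          {0} \<union> to_disk ` zero_locus f \<union> \<Union>\<A>) \<and>
     (\<forall>p\<in>R. F p \<noteq> 0) \<and>
     flow_exits_through F R (zero_locus f) \<and>
     (\<forall>p. critical_at_infinity n F p \<longrightarrow> p \<in> closure (to_disk ` R) \<longrightarrow>
        \<not> disk_sink n F p \<and> \<not> disk_source n F p)"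


section \<open>Consistency of the compactification\<close>

lemma poincare_disk_eq: "poincare_disk = cball 0 1"
proof (intro equalityI subsetI)
  fix p assume "p \<in> poincare_disk"
  then obtain X Y Z where *: "p = (X, Y)" "X ^ 2 + Y ^ 2 + Z ^ 2 = 1"
    by (auto simp: poincare_disk_def hemisphere_def disk_proj_def)
  then have "X ^ 2 + Y ^ 2 \<le> 1"
    by (metis le_add_same_cancel1 zero_le_power2)
  then show "p \<in> cball 0 1" by (simp add: * norm_Pair)
next
  fix p :: plane assume p: "p \<in> cball 0 1"
  obtain X Y where XY: "p = (X, Y)" by (cases p)
  have "X ^ 2 + Y ^ 2 \<le> 1" using p by (simp add: XY norm_Pair)
  then have "(X, Y, sqrt (1 - X ^ 2 - Y ^ 2)) \<in> hemisphere"
    by (simp add: hemisphere_def)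
  then show "p \<in> poincare_disk"
    unfolding poincare_disk_def XY by (force simp: disk_proj_def)
qed

lemma to_hemisphere_in: "to_hemisphere p \<in> hemisphere"
proof -
  obtain x y where p: "p = (x, y)" by (cases p)
  have pos: "x ^ 2 + y ^ 2 + 1 > 0" by (simp add: add_nonneg_pos)
  show ?thesis
    using pos
    by (simp add: p to_hemisphere_def hemisphere_def power_divide add_divide_distrib[symmetric])
qed

lemma homogenize_eq:
  assumes "Z \<noteq> 0" "continuous_on UNIV g"
  shows "homogenize n g (X, Y, Z) = Z ^ n * g (X / Z, Y / Z)"
proof -
  have "isCont g (X / Z, Y / Z)" using assms by (simp add: continuous_on_eq_continuous_at)
  moreover have "((\<lambda>z. (X / z, Y / z)) \<longlongrightarrow> (X / Z, Y / Z)) (at Z)"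
    using assms by (intro tendsto_intros) auto
  ultimately have "((\<lambda>z. g (X / z, Y / z)) \<longlongrightarrow> g (X / Z, Y / Z)) (at Z)"
    by (rule isCont_tendsto_compose)
  then have "((\<lambda>z. z ^ n * g (X / z, Y / z)) \<longlongrightarrow> Z ^ n * g (X / Z, Y / Z)) (at Z)"
    by (intro tendsto_intros)
  then show ?thesis by (simp add: homogenize_def tendsto_Lim)
qed

lemma compactified_field_pushforward:
  assumes n: "n \<ge> 1" and cont: "continuous_on UNIV F" and sol: "solves_on F \<gamma> S" and t: "t \<in> S"
  defines "Z \<equiv> 1 / sqrt (fst (\<gamma> t) ^ 2 + snd (\<gamma> t) ^ 2 + 1)"
  shows "((\<lambda>s. to_hemisphere (\<gamma> s)) has_vector_derivative
           (1 / Z ^ (n - 1)) *\<^sub>R compactified_field n F (to_hemisphere (\<gamma> t))) (at t within S)"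
proof -
  obtain x y where xy: "\<gamma> t = (x, y)" by (cases "\<gamma> t")
  obtain P Q where PQ: "F (\<gamma> t) = (P, Q)" by (cases "F (\<gamma> t)")
  have pos: "x ^ 2 + y ^ 2 + 1 > 0" by (simp add: add_nonneg_pos)
  have Z: "Z = 1 / sqrt (x ^ 2 + y ^ 2 + 1)" "Z > 0" using pos by (auto simp: Z_def xy)
  have h: "to_hemisphere (\<gamma> t) = (Z * x, Z * y, Z)" by (simp add: to_hemisphere_def xy Z)
  have hP: "homogenize n (\<lambda>p. fst (F p)) (Z * x, Z * y, Z) = Z ^ n * P"
    using Z(2) PQ by (subst homogenize_eq) (auto intro!: continuous_intros cont simp: xy)
  have hQ: "homogenize n (\<lambda>p. snd (F p)) (Z * x, Z * y, Z) = Z ^ n * Q"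
    using Z(2) PQ by (subst homogenize_eq) (auto intro!: continuous_intros cont simp: xy)
  have zn: "Z ^ n = Z * Z ^ (n - 1)" using n by (cases n) auto
  have field: "(1 / Z ^ (n - 1)) *\<^sub>R compactified_field n F (to_hemisphere (\<gamma> t)) =
     (Z * P - Z ^ 3 * x * (x * P + y * Q), Z * Q - Z ^ 3 * y * (x * P + y * Q),
      - (Z ^ 3 * (x * P + y * Q)))"
    using Z(2)
    by (simp add: h compactified_field_def hP hQ Let_def zn field_simps power3_eq_cube)
  have d: "(\<gamma> has_vector_derivative (P, Q)) (at t within S)"
    using sol t PQ by (auto simp: solves_on_def)
  have d1: "((\<lambda>s. fst (\<gamma> s)) has_real_derivative P) (at t within S)"
    using bounded_linear.has_vector_derivative[OF bounded_linear_fst d]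
    by (simp add: has_real_derivative_iff_has_vector_derivative)
  have d2: "((\<lambda>s. snd (\<gamma> s)) has_real_derivative Q) (at t within S)"
    using bounded_linear.has_vector_derivative[OF bounded_linear_snd d]
    by (simp add: has_real_derivative_iff_has_vector_derivative)
  let ?w = "\<lambda>s. 1 / sqrt (fst (\<gamma> s) ^ 2 + snd (\<gamma> s) ^ 2 + 1)"
  have sq: "((\<lambda>s. sqrt (fst (\<gamma> s) ^ 2 + snd (\<gamma> s) ^ 2 + 1)) has_real_derivative
       (x * P + y * Q) / sqrt (x ^ 2 + y ^ 2 + 1)) (at t within S)"
    using pos by (auto intro!: derivative_eq_intros d1 d2 simp: xy field_simps)
  have dw: "(?w has_real_derivative - (Z ^ 3 * (x * P + y * Q))) (at t within S)"
    by (rule derivative_eq_intros sq refl)+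
      (use pos in \<open>auto simp: xy Z(1) power3_eq_cube field_simps\<close>)
  have "((\<lambda>s. (?w s * fst (\<gamma> s), ?w s * snd (\<gamma> s), ?w s)) has_vector_derivative
     (- (Z ^ 3 * (x * P + y * Q)) * x + P * Z, - (Z ^ 3 * (x * P + y * Q)) * y + Q * Z,
      - (Z ^ 3 * (x * P + y * Q)))) (at t within S)"
    using DERIV_mult[OF dw d1] DERIV_mult[OF dw d2] dw
    by (intro has_vector_derivative_Pair)
      (simp_all add: has_real_derivative_iff_has_vector_derivative[symmetric] xy Z)
  moreover have "(\<lambda>s. to_hemisphere (\<gamma> s)) = (\<lambda>s. (?w s * fst (\<gamma> s), ?w s * snd (\<gamma> s), ?w s))"
    by (auto simp: to_hemisphere_def split: prod.splits)
  ultimately show ?thesis unfolding field by (simp add: algebra_simps)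
qed

lemma homogenize_system:
  "homogenize 3 (\<lambda>p. fst (system \<delta> p)) (X, Y, Z) = Y * Z ^ 2"
  "homogenize 3 (\<lambda>p. snd (system \<delta> p)) (X, Y, Z) = - (X ^ 3) + \<delta> * X ^ 2 * Y + Y ^ 3"
proof -
  have ev: "eventually (\<lambda>z::real. z \<noteq> 0) (at Z)"
    by (cases "Z = 0") (auto intro: eventually_neq_at_within)
  have "((\<lambda>z. Y * z ^ 2) \<longlongrightarrow> Y * Z ^ 2) (at Z)" by (intro tendsto_intros)
  then have "((\<lambda>z. z ^ 3 * fst (system \<delta> (X / z, Y / z))) \<longlongrightarrow> Y * Z ^ 2) (at Z)"
    by (rule Lim_transform_eventually)
      (use ev in \<open>eventually_elim, auto simp: system_def power2_eq_square power3_eq_cube\<close>)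
  then show "homogenize 3 (\<lambda>p. fst (system \<delta> p)) (X, Y, Z) = Y * Z ^ 2"
    by (simp add: homogenize_def tendsto_Lim)
  let ?q = "- (X ^ 3) + \<delta> * X ^ 2 * Y + Y ^ 3"
  have "((\<lambda>z. z ^ 3 * snd (system \<delta> (X / z, Y / z))) \<longlongrightarrow> ?q) (at Z)"
    by (rule Lim_transform_eventually[OF tendsto_const])
      (use ev in \<open>eventually_elim, auto simp: system_def power2_eq_square power3_eq_cube field_simps\<close>)
  then show "homogenize 3 (\<lambda>p. snd (system \<delta> p)) (X, Y, Z) = ?q"
    by (simp add: homogenize_def tendsto_Lim)
qed

end

theory Submission
  imports Defs
begin

text \<open>One hyperbola serves every \<open>\<delta>\<close> in the range: \<open>3 (x + 2 y) (y - 2 x) = 5\<close>, a rectangular hyperbola with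
  asymptotes of slopes \<open>- 1 / 2\<close> and \<open>2\<close>. The region is the part between its two branches, minus the
  origin. It is enough that \<open>- 53 / 25 \<le> \<delta> < 0\<close>, and the constant in the theorem is at most \<open>53 / 25\<close> in
  absolute value.

  On the hyperbola the orbital derivative becomes a binary quartic form, because the quadratic part may
  be multiplied by \<open>3 (x + 2 y) (y - 2 x) / 5 = 1\<close>. On the cone where that form is positive, the quartic
  is nondecreasing in \<open>\<delta>\<close>, and at \<open>\<delta> = - 53 / 25\<close> it is an explicit sum of squares plus a positive multiple
  of the form (\<open>orbital_deriv_pos_on_hyperbola\<close>). So the flow leaves the region transversally through both
  branches.

  The linear part of the system at the origin is nilpotent, so stability needs a Lyapunov function; the
  energy \<open>y\<^sup>2 / 2 + x\<^sup>4 / 4\<close> is corrected by small terms of higher weight to one with strictly negative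
  derivative (\<open>origin_asymptotically_stable\<close>).

  In the disk, the closure of the region meets the equator in two opposite quarter circles, the directions
  with slopes in \<open>[- 1 / 2, 2]\<close>. A critical point \<open>(x, y)\<close> of the flow there has slope \<open>m\<close> with
  \<open>m\<^sup>3 + \<delta> m = 1\<close>, and such an \<open>m\<close> is positive, hence unique and a simple root
  (\<open>critical_at_infinity_in_region\<close>). The sinks \<open>(0, 1)\<close> and \<open>(0, - 1)\<close> are excluded, and so are the critical
  points with negative slope that appear when \<open>\<delta>\<close> is near the lower end of the range, some of which are
  sources. Near a remaining critical point, \<open>m\<close> is repelled from its
  critical value along the equator, so it is not a sink, while interior orbits move towards the equator, so it
  is not a source. Both claims need orbits that exist for all times, which a Picard argument on the
  sphere provides (\<open>hemisphere_orbits_exist\<close>).\<close>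

section \<open>Global solutions of Lipschitz vector fields\<close>

lemma integral_has_vector_derivative_halfline:
  fixes h :: "real \<Rightarrow> 'a::banach"
  assumes h: "continuous_on {0..} h" and r: "0 \<le> r"
  shows "((\<lambda>r. integral {0..r} h) has_vector_derivative h r) (at r within {0..})"
proof -
  have "((\<lambda>r. integral {0..r} h) has_vector_derivative h r) (at r within {0..r + 1})"
    by (rule integral_has_vector_derivative) (use r in \<open>auto intro: continuous_on_subset[OF h]\<close>)
  moreover have "at r within {0..r + 1} = at r within {0..}"
    by (rule at_within_nhd[of _ "{..<r + 1}"]) (use r in auto)
  ultimately show ?thesis by simp
qed

text \<open>The integral of \<open>K exp (2 K s)\<close> up to \<open>t\<close> is less than \<open>exp (2 K t) / 2\<close>. The factor \<open>1 / 2\<close> becomes the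
  contraction constant of the Picard operator below.\<close>

lemma exponentially_weighted_integral_bound:
  fixes h :: "real \<Rightarrow> 'a::banach"
  assumes h: "continuous_on {0..} h" and t: "0 \<le> t" and "0 \<le> d"
    and bound: "\<And>s. 0 \<le> s \<Longrightarrow> norm (h s) \<le> K * d * exp (2 * K * s)"
  shows "norm (exp (- 2 * K * t) *\<^sub>R integral {0..t} h) \<le> d / 2"
proof -
  have I: "((\<lambda>s. K * d * exp (2 * K * s)) has_integral
      (d / 2 * exp (2 * K * t) - d / 2 * exp (2 * K * 0))) {0..t}"
    by (rule fundamental_theorem_of_calculus[OF t])
      (auto intro!: derivative_eq_intros simp: has_real_derivative_iff_has_vector_derivative[symmetric])
  have "norm (integral {0..t} h) \<le> integral {0..t} (\<lambda>s. K * d * exp (2 * K * s))"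
    by (rule integral_norm_bound_integral)
      (use t bound in \<open>auto intro!: integrable_continuous_real continuous_intros continuous_on_subset[OF h]\<close>)
  also have "\<dots> \<le> d / 2 * exp (2 * K * t)"
    using integral_unique[OF I] \<open>0 \<le> d\<close> by simp
  finally have "exp (- 2 * K * t) * norm (integral {0..t} h) \<le> exp (- 2 * K * t) * (d / 2 * exp (2 * K * t))"
    by (intro mult_left_mono) auto
  also have "\<dots> = d / 2" by (simp add: exp_minus)
  finally show ?thesis by simp
qed

text \<open>Writing \<open>\<gamma> t = x0 + exp (2 K t) u t\<close> turns the integral equation into a fixed point problem for a bounded
  continuous \<open>u\<close>. With this weight the Picard operator is a contraction on the whole half-line at once, so
  no continuation of local solutions is needed. Since bounded continuous functions here live on all of
  \<open>real\<close>, negative times are clamped to \<open>0\<close>.\<close>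

theorem lipschitz_field_global_solution:
  fixes F :: "'a::banach \<Rightarrow> 'a"
  assumes F: "L-lipschitz_on UNIV F"
  shows "\<exists>\<gamma>. \<gamma> 0 = x0 \<and> solves_on F \<gamma> {0..}"
proof -
  define K where "K = L + 1"
  have L0: "0 \<le> L" using F by (rule lipschitz_on_nonneg)
  have K: "K \<ge> 1" "K > 0" using L0 by (auto simp: K_def)
  have FK: "norm (F x - F y) \<le> K * norm (x - y)" for x y
  proof -
    have "norm (F x - F y) \<le> L * norm (x - y)"
      using lipschitz_onD[OF F, of x y] by (simp add: dist_norm)
    also have "\<dots> \<le> K * norm (x - y)" by (intro mult_right_mono) (auto simp: K_def)
    finally show ?thesis .
  qed
  have contF: "continuous_on UNIV F" using F by (rule lipschitz_on_continuous_on)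
  define h where "h u s = F (x0 + exp (2 * K * s) *\<^sub>R apply_bcontfun u s)" for u s
  define T where "T u t = exp (- 2 * K * t) *\<^sub>R integral {0..t} (h u)" for u t
  have conth: "continuous_on S (h u)" for u S
    unfolding h_def
    by (rule continuous_on_compose2[OF contF]) (auto intro!: continuous_intros)
  have bdT: "norm (T u t) \<le> (norm u + norm (F x0)) / 2" if "0 \<le> t" for u t
    unfolding T_def
  proof (rule exponentially_weighted_integral_bound[OF conth that])
    fix s :: real assume "0 \<le> s"
    then have e1: "1 \<le> exp (2 * K * s)" using K by simp
    have "norm (h u s) \<le> norm (F x0) + norm (h u s - F x0)"
      by (metis add.commute norm_triangle_sub)
    also have "norm (h u s - F x0) \<le> K * (exp (2 * K * s) * norm (apply_bcontfun u s))"
      using FK[of "x0 + exp (2 * K * s) *\<^sub>R apply_bcontfun u s" x0] by (simp add: h_def)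
    also have "\<dots> \<le> K * (exp (2 * K * s) * norm u)"
      using K by (intro mult_left_mono norm_bounded) auto
    also have "norm (F x0) \<le> K * (exp (2 * K * s) * norm (F x0))"
      using K(1) e1 mult_mono[of 1 K 1 "exp (2 * K * s)"] mult_right_mono[of 1 "K * exp (2 * K * s)" "norm (F x0)"]
      by (simp add: mult.assoc)
    finally show "norm (h u s) \<le> K * (norm u + norm (F x0)) * exp (2 * K * s)"
      by (simp add: algebra_simps)
  qed auto
  have contJ: "continuous_on {0..} (\<lambda>t. integral {0..t} (h u))" for u
    using integral_has_vector_derivative_halfline[OF conth]
    by (meson atLeast_iff continuous_on_eq_continuous_within has_vector_derivative_continuous)
  have "\<exists>v. \<forall>t. apply_bcontfun v t = T u (max t 0)" for u
  proof -
    have "continuous_on UNIV (\<lambda>t. T u (max t 0))"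
      unfolding T_def
      by (intro continuous_intros continuous_on_compose2[OF contJ]) auto
    moreover have "norm (T u (max t 0)) \<le> (norm u + norm (F x0)) / 2" for t
      by (rule bdT) simp
    ultimately have "(\<lambda>t. T u (max t 0)) \<in> bcontfun"
      by (rule bcontfun_normI)
    then show ?thesis by (metis Bcontfun_inverse)
  qed
  then obtain \<Phi> where \<Phi>: "apply_bcontfun (\<Phi> u) t = T u (max t 0)" for u t
    by metis
  have contr: "dist (\<Phi> u) (\<Phi> v) \<le> 1 / 2 * dist u v" for u v
  proof (rule dist_bound)
    fix t :: real
    let ?r = "max t 0"
    have "norm (exp (- 2 * K * ?r) *\<^sub>R integral {0..?r} (\<lambda>s. h u s - h v s)) \<le> dist u v / 2"
    proof (rule exponentially_weighted_integral_bound)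
      show "continuous_on {0..} (\<lambda>s. h u s - h v s)" by (intro continuous_intros conth)
      fix s :: real
      have "norm (h u s - h v s) \<le> K * (exp (2 * K * s) * norm (apply_bcontfun u s - apply_bcontfun v s))"
        unfolding h_def
        by (rule order_trans[OF FK]) (simp add: scaleR_diff_right[symmetric])
      also have "\<dots> \<le> K * (exp (2 * K * s) * dist u v)"
        using K dist_bounded[of u s v]
        by (intro mult_left_mono) (auto simp: dist_norm[of "apply_bcontfun u s"])
      finally show "norm (h u s - h v s) \<le> K * dist u v * exp (2 * K * s)"
        by (simp add: algebra_simps)
    qed auto
    moreover have "integral {0..?r} (\<lambda>s. h u s - h v s) = integral {0..?r} (h u) - integral {0..?r} (h v)"
      by (intro integral_diff integrable_continuous_real conth)
    ultimately show "dist (apply_bcontfun (\<Phi> u) t) (apply_bcontfun (\<Phi> v) t) \<le> 1 / 2 * dist u v"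
      by (simp add: \<Phi> T_def dist_norm scaleR_diff_right)
  qed
  obtain u where u: "\<Phi> u = u"
    using banach_fix_type[of "1 / 2" \<Phi>] contr by auto
  define \<gamma> where "\<gamma> t = x0 + integral {0..t} (h u)" for t
  have hu: "h u t = F (\<gamma> t)" if "0 \<le> t" for t
  proof -
    have "apply_bcontfun u t = T u t" using \<Phi>[of u t] u that by simp
    then show ?thesis by (simp add: h_def \<gamma>_def T_def exp_minus)
  qed
  have "solves_on F \<gamma> {0..}"
    unfolding solves_on_def
  proof
    fix t :: real assume t: "t \<in> {0..}"
    have "(\<gamma> has_vector_derivative 0 + h u t) (at t within {0..})"
      unfolding \<gamma>_def
      by (intro derivative_intros integral_has_vector_derivative_halfline conth) (use t in auto)
    then show "(\<gamma> has_vector_derivative F (\<gamma> t)) (at t within {0..})"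
      using hu t by simp
  qed
  moreover have "\<gamma> 0 = x0" by (simp add: \<gamma>_def)
  ultimately show ?thesis by blast
qed

section \<open>Differential inequalities and the Lyapunov criterion\<close>

lemma solves_on_has_real_derivative:
  fixes F :: "'a::real_normed_vector \<Rightarrow> 'a" and V :: "'a \<Rightarrow> real"
  assumes "solves_on F \<gamma> S" "t \<in> S" "(V has_derivative V') (at (\<gamma> t))"
  shows "((\<lambda>t. V (\<gamma> t)) has_real_derivative V' (F (\<gamma> t))) (at t within S)"
proof -
  have "(\<gamma> has_vector_derivative F (\<gamma> t)) (at t within S)"
    using assms by (auto simp: solves_on_def)
  then have "((\<lambda>t. V (\<gamma> t)) has_derivative (\<lambda>h. V' (h *\<^sub>R F (\<gamma> t)))) (at t within S)"
    using assms(3) unfolding has_vector_derivative_def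
    by (rule has_derivative_compose)
  moreover have "V' (h *\<^sub>R F (\<gamma> t)) = V' (F (\<gamma> t)) * h" for h
    using has_derivative_linear[OF assms(3)] by (simp add: linear_scale)
  ultimately show ?thesis by (simp add: has_field_derivative_def)
qed

lemma solves_on_subset: "solves_on F \<gamma> S \<Longrightarrow> T \<subseteq> S \<Longrightarrow> solves_on F \<gamma> T"
  unfolding solves_on_def by (meson has_vector_derivative_within_subset subsetD)

lemma solves_on_continuous_on: "solves_on F \<gamma> S \<Longrightarrow> continuous_on S \<gamma>"
  unfolding solves_on_def continuous_on_eq_continuous_within
  using has_vector_derivative_continuous by blast

lemma nonpos_derivative_within_imp_le:
  fixes f :: "real \<Rightarrow> real"
  assumes "a \<le> b"
    and der: "\<And>t. t \<in> {a..b} \<Longrightarrow> (f has_real_derivative f' t) (at t within {a..b})"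
    and "\<And>t. t \<in> {a..b} \<Longrightarrow> f' t \<le> 0"
  shows "f b \<le> f a"
proof -
  have "\<exists>t\<in>{a..b}. f b - f a = f' t * (b - a)"
    using mvt_very_simple[of a b f "\<lambda>t h. f' t * h"] assms(1) der
    by (auto simp: has_field_derivative_def mult_commute_abs)
  then obtain t where "t \<in> {a..b}" "f b - f a = f' t * (b - a)" by blast
  then show ?thesis
    using mult_nonpos_nonneg[of "f' t" "b - a"] assms by auto
qed

text \<open>Gronwall in the form needed for invariance and uniqueness: \<open>s\<^sup>2 exp (- 2 L t)\<close> does not increase and
  \<open>s\<^sup>2 exp (2 L t)\<close> does not decrease, so a zero of \<open>s\<close> spreads in both time directions.\<close>

lemma linear_differential_inequality_zero:
  fixes s :: "real \<Rightarrow> real"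
  assumes S: "is_interval S" and "a \<in> S" "b \<in> S" and "s a = 0"
    and der: "\<And>t. t \<in> S \<Longrightarrow> (s has_real_derivative s' t) (at t within S)"
    and bound: "\<And>t. t \<in> S \<Longrightarrow> \<bar>s' t\<bar> \<le> L * \<bar>s t\<bar>"
  shows "s b = 0"
proof -
  have d: "((\<lambda>t. (s t)\<^sup>2 * exp (c * t)) has_real_derivative
      (2 * (s t * s' t) + c * (s t)\<^sup>2) * exp (c * t)) (at t within S)" if "t \<in> S" for c t
    by (auto intro!: derivative_eq_intros der[OF that] simp: algebra_simps)
  have ss: "\<bar>s t * s' t\<bar> \<le> L * (s t)\<^sup>2" if "t \<in> S" for t
    using mult_left_mono[OF bound[OF that], of "\<bar>s t\<bar>"]
    by (simp add: abs_mult power2_eq_square mult.left_commute)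
  have sub: "{x..y} \<subseteq> S" if "x \<in> S" "y \<in> S" for x y
    using S that by (meson atLeastAtMost_iff is_interval_1 subsetI)
  show ?thesis
  proof (cases "a \<le> b")
    case True
    have "(s b)\<^sup>2 * exp (- (2 * L) * b) \<le> (s a)\<^sup>2 * exp (- (2 * L) * a)"
    proof (rule nonpos_derivative_within_imp_le[where f = "\<lambda>t. (s t)\<^sup>2 * exp (- (2 * L) * t)", OF True])
      fix t assume "t \<in> {a..b}"
      then have t: "t \<in> S" using sub assms by blast
      show "((\<lambda>t. (s t)\<^sup>2 * exp (- (2 * L) * t)) has_real_derivative
          (2 * (s t * s' t) + - (2 * L) * (s t)\<^sup>2) * exp (- (2 * L) * t)) (at t within {a..b})"
        by (rule DERIV_subset[OF d[OF t]]) (use sub assms in blast)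
      show "(2 * (s t * s' t) + - (2 * L) * (s t)\<^sup>2) * exp (- (2 * L) * t) \<le> 0"
        using ss[OF t] by (intro mult_nonpos_nonneg) auto
    qed
    then show ?thesis using \<open>s a = 0\<close> by (simp add: mult_le_0_iff)
  next
    case False
    then have "b \<le> a" by simp
    have "- ((s a)\<^sup>2 * exp (2 * L * a)) \<le> - ((s b)\<^sup>2 * exp (2 * L * b))"
    proof (rule nonpos_derivative_within_imp_le[where f = "\<lambda>t. - ((s t)\<^sup>2 * exp (2 * L * t))", OF \<open>b \<le> a\<close>])
      fix t assume "t \<in> {b..a}"
      then have t: "t \<in> S" using sub assms by blast
      show "((\<lambda>t. - ((s t)\<^sup>2 * exp (2 * L * t))) has_real_derivative
          - ((2 * (s t * s' t) + 2 * L * (s t)\<^sup>2) * exp (2 * L * t))) (at t within {b..a})"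
        by (intro DERIV_minus DERIV_subset[OF d[OF t]]) (use sub assms in blast)
      show "- ((2 * (s t * s' t) + 2 * L * (s t)\<^sup>2) * exp (2 * L * t)) \<le> 0"
        using ss[OF t] by auto
    qed
    then show ?thesis using \<open>s a = 0\<close> by (simp add: mult_le_0_iff)
  qed
qed

text \<open>Stability: an orbit that starts where \<open>V\<close> is below its minimum on a small sphere cannot reach that sphere.
  Attraction: an orbit that never enters a given neighbourhood of \<open>0\<close> stays in a compact annulus, where \<open>V\<close>
  decreases at a rate bounded away from \<open>0\<close> and would become negative; once inside the neighbourhood,
  stability keeps the orbit close to \<open>0\<close>.\<close>

theorem strict_Lyapunov_function_imp_asymptotically_stable:
  fixes F :: "'a::euclidean_space \<Rightarrow> 'a" and V :: "'a \<Rightarrow> real"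
  assumes F0: "F 0 = 0" and r: "0 < r"
    and V': "\<And>p. (V has_derivative V' p) (at p)"
    and cont: "continuous_on UNIV (\<lambda>p. V' p (F p))"
    and V0: "V 0 = 0"
    and pos: "\<And>p. p \<in> cball 0 r \<Longrightarrow> p \<noteq> 0 \<Longrightarrow> 0 < V p"
    and neg: "\<And>p. p \<in> cball 0 r \<Longrightarrow> p \<noteq> 0 \<Longrightarrow> V' p (F p) < 0"
  shows "asymptotically_stable F 0"
proof -
  have contV: "continuous_on S V" for S
    by (meson V' continuous_at_imp_continuous_on has_derivative_continuous)
  have V'0: "V' p (F p) \<le> 0" if "norm p \<le> r" for p
    using neg[of p] that F0 has_derivative_linear[OF V', of 0] by (cases "p = 0") (auto simp: linear_0)
  have dV: "((\<lambda>t. V (\<gamma> t)) has_real_derivative V' (\<gamma> t) (F (\<gamma> t))) (at t within S)"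
    if "solves_on F \<gamma> S" "t \<in> S" for \<gamma> S t
    by (rule solves_on_has_real_derivative[OF that V'])
  have decr: "V (\<gamma> b) \<le> V (\<gamma> a)"
    if sol: "solves_on F \<gamma> {a..b}" and "a \<le> b" and "\<And>t. t \<in> {a..b} \<Longrightarrow> norm (\<gamma> t) \<le> r" for \<gamma> a b
    by (rule nonpos_derivative_within_imp_le[where f = "\<lambda>t. V (\<gamma> t)", OF \<open>a \<le> b\<close> dV[OF sol]])
      (use that V'0 in auto)
  have stable: "\<exists>\<eta>>0. \<forall>a T \<gamma>. solves_on F \<gamma> {a..T} \<longrightarrow> norm (\<gamma> a) < \<eta> \<longrightarrow> (\<forall>t\<in>{a..T}. norm (\<gamma> t) < \<epsilon>)"
    if \<epsilon>: "0 < \<epsilon>" "\<epsilon> \<le> r" for \<epsilon>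
  proof -
    obtain m where m: "0 < m" "\<And>p. norm p = \<epsilon> \<Longrightarrow> m \<le> V p"
    proof (cases "sphere (0::'a) \<epsilon> = {}")
      case True
      then show ?thesis using that[of 1] \<epsilon> by auto
    next
      case False
      obtain q where "q \<in> sphere 0 \<epsilon>" "\<And>p. p \<in> sphere 0 \<epsilon> \<Longrightarrow> V q \<le> V p"
        using continuous_attains_inf[OF compact_sphere False contV] by blast
      then show ?thesis
        using that[of "V q"] pos[of q] \<epsilon> by auto
    qed
    have "isCont V 0" using contV[of UNIV] by (simp add: continuous_on_eq_continuous_at)
    then obtain d where d: "d > 0" "\<And>p. norm p < d \<Longrightarrow> \<bar>V p\<bar> < m"
      using m(1) V0 by (auto simp: continuous_at_eps_delta dist_norm)
    show ?thesis
    proof (intro exI[of _ "min d \<epsilon>"] conjI allI impI ballI)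
      show "0 < min d \<epsilon>" using d \<epsilon> by simp
      fix a T \<gamma> t
      assume sol: "solves_on F \<gamma> {a..T}" and a: "norm (\<gamma> a) < min d \<epsilon>" and t: "t \<in> {a..T}"
      show "norm (\<gamma> t) < \<epsilon>"
      proof (rule ccontr)
        assume far: "\<not> norm (\<gamma> t) < \<epsilon>"
        \<comment> \<open>the first time \<open>\<tau>\<close> at which the orbit reaches the sphere of radius \<open>\<epsilon>\<close>\<close>
        define B where "B = {s \<in> {a..t}. norm (\<gamma> s) \<in> {\<epsilon>..}}"
        have c: "continuous_on {a..t} (\<lambda>s. norm (\<gamma> s))"
          by (intro continuous_intros continuous_on_subset[OF solves_on_continuous_on[OF sol]]) (use t in auto)
        have "closed B"
          unfolding B_def using continuous_closed_preimage[OF c, of "{\<epsilon>..}"] by (simp add: vimage_def Int_def)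
        moreover have "t \<in> B" using far t by (auto simp: B_def)
        moreover have bb: "bdd_below B" by (auto simp: B_def)
        ultimately have inf: "Inf B \<in> B" by (intro closed_contains_Inf) auto
        define \<tau> where "\<tau> = Inf B"
        have \<tau>: "a \<le> \<tau>" "\<tau> \<le> t" "\<epsilon> \<le> norm (\<gamma> \<tau>)" using inf by (auto simp: B_def \<tau>_def)
        have before: "norm (\<gamma> s) < \<epsilon>" if "a \<le> s" "s < \<tau>" for s
          using cInf_lower[OF _ bb, of s] that \<tau> by (force simp: B_def \<tau>_def)
        obtain s where s: "a \<le> s" "s \<le> \<tau>" "norm (\<gamma> s) = \<epsilon>"
          using IVT'[of "\<lambda>s. norm (\<gamma> s)" a \<epsilon> \<tau>] a \<tau> continuous_on_subset[OF c, of "{a..\<tau>}"] by auto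
        then have "s = \<tau>" using before by force
        have "V (\<gamma> \<tau>) \<le> V (\<gamma> a)"
        proof (rule decr)
          show "solves_on F \<gamma> {a..\<tau>}" using sol \<tau> t by (auto intro: solves_on_subset)
          show "norm (\<gamma> s') \<le> r" if "s' \<in> {a..\<tau>}" for s'
            using before[of s'] that \<epsilon> s \<open>s = \<tau>\<close> by (cases "s' = \<tau>") auto
        qed fact
        moreover have "V (\<gamma> a) < m" using d(2)[of "\<gamma> a"] a by simp
        moreover have "m \<le> V (\<gamma> \<tau>)" using m(2) s \<open>s = \<tau>\<close> by simp
        ultimately show False by simp
      qed
    qed
  qed
  show ?thesis
    unfolding asymptotically_stable_def
  proof (intro conjI allI impI)
    show "F 0 = 0" by fact
    fix \<epsilon> :: real assume "0 < \<epsilon>"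
    then obtain \<eta> where \<eta>: "\<eta> > 0"
      "\<And>a T \<gamma>. solves_on F \<gamma> {a..T} \<Longrightarrow> norm (\<gamma> a) < \<eta> \<Longrightarrow> (\<forall>t\<in>{a..T}. norm (\<gamma> t) < min \<epsilon> r)"
      using stable[of "min \<epsilon> r"] r by auto
    show "\<exists>\<eta>>0. \<forall>T>0. \<forall>\<gamma>. solves_on F \<gamma> {0..<T} \<longrightarrow> dist (\<gamma> 0) 0 < \<eta> \<longrightarrow>
        (\<forall>t\<in>{0..<T}. dist (\<gamma> t) 0 < \<epsilon>)"
    proof (intro exI[of _ \<eta>] conjI allI impI ballI)
      fix T \<gamma> t
      assume sol: "solves_on F \<gamma> {0..<T}" and start: "dist (\<gamma> 0) 0 < \<eta>" and t: "t \<in> {0..<T}"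
      have "solves_on F \<gamma> {0..t}"
        by (rule solves_on_subset[OF sol]) (use t in auto)
      from \<eta>(2)[OF this] have "\<forall>s\<in>{0..t}. norm (\<gamma> s) < min \<epsilon> r"
        using start by simp
      then show "dist (\<gamma> t) 0 < \<epsilon>"
        using t by simp
    qed fact
  next
    obtain \<eta> where \<eta>: "\<eta> > 0"
      "\<And>a T \<gamma>. solves_on F \<gamma> {a..T} \<Longrightarrow> norm (\<gamma> a) < \<eta> \<Longrightarrow> (\<forall>t\<in>{a..T}. norm (\<gamma> t) < r)"
      using stable[of r] r by auto
    show "\<exists>\<eta>>0. \<forall>\<gamma>. solves_on F \<gamma> {0..} \<longrightarrow> dist (\<gamma> 0) 0 < \<eta> \<longrightarrow> (\<gamma> \<longlongrightarrow> 0) at_top"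
    proof (intro exI[of _ \<eta>] conjI allI impI)
      fix \<gamma> assume sol: "solves_on F \<gamma> {0..}" and start: "dist (\<gamma> 0) 0 < \<eta>"
      have inr: "norm (\<gamma> t) < r" if "0 \<le> t" for t
        using \<eta>(2)[of \<gamma> 0 t] solves_on_subset[OF sol, of "{0..t}"] start that by auto
      show "(\<gamma> \<longlongrightarrow> 0) at_top"
      proof (rule tendstoI)
        fix \<epsilon> :: real assume "0 < \<epsilon>"
        then obtain d where d: "d > 0"
          "\<And>a T \<gamma>. solves_on F \<gamma> {a..T} \<Longrightarrow> norm (\<gamma> a) < d \<Longrightarrow> (\<forall>t\<in>{a..T}. norm (\<gamma> t) < min \<epsilon> r)"
          using stable[of "min \<epsilon> r"] r by auto
        have "\<exists>a\<ge>0. norm (\<gamma> a) < d"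
        proof (rule ccontr)
          assume "\<not> ?thesis"
          then have far: "d \<le> norm (\<gamma> t)" if "0 \<le> t" for t using that by force
          define A where "A = cball (0::'a) r - ball 0 d"
          have A: "compact A" unfolding A_def by (intro compact_diff) auto
          have inA: "\<gamma> t \<in> A" if "0 \<le> t" for t
            using far[OF that] inr[OF that] by (simp add: A_def)
          obtain q where q: "q \<in> A" "\<And>p. p \<in> A \<Longrightarrow> V' p (F p) \<le> V' q (F q)"
            using continuous_attains_sup[OF A _ continuous_on_subset[OF cont subset_UNIV]] inA[of 0]
            by auto
          define k where "k = - V' q (F q)"
          have k: "k > 0" using neg[of q] q(1) d(1) by (cases "q = 0") (auto simp: A_def k_def)
          \<comment> \<open>by this time a loss at rate \<open>k\<close> exceeds \<open>V (\<gamma> 0)\<close>\<close>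
          define t where "t = (V (\<gamma> 0) + 1) / k"
          have V0pos: "0 \<le> V (\<gamma> s)" if "0 \<le> s" for s
            using pos[of "\<gamma> s"] inA[OF that] V0 by (cases "\<gamma> s = 0") (auto simp: A_def intro: less_imp_le)
          have t0: "0 \<le> t" using V0pos[of 0] k by (simp add: t_def)
          have "V (\<gamma> t) + k * t \<le> V (\<gamma> 0) + k * 0"
          proof (rule nonpos_derivative_within_imp_le[where f = "\<lambda>t. V (\<gamma> t) + k * t", OF t0])
            fix s assume s: "s \<in> {0..t}"
            show "((\<lambda>t. V (\<gamma> t) + k * t) has_real_derivative V' (\<gamma> s) (F (\<gamma> s)) + k) (at s within {0..t})"
              by (auto intro!: derivative_eq_intros DERIV_subset[OF dV[OF sol]] s) (use s in auto)
            show "V' (\<gamma> s) (F (\<gamma> s)) + k \<le> 0"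
              using q(2)[of "\<gamma> s"] inA s by (simp add: k_def)
          qed
          then have "V (\<gamma> t) + 1 \<le> 0" using k by (simp add: t_def)
          then show False using V0pos[OF t0] by simp
        qed
        then obtain a where a: "0 \<le> a" "norm (\<gamma> a) < d" by blast
        have "dist (\<gamma> t) 0 < \<epsilon>" if "a \<le> t" for t
          using d(2)[OF solves_on_subset[OF sol, of "{a..t}"] a(2)] a(1) that by auto
        then show "\<forall>\<^sub>F t in at_top. dist (\<gamma> t) 0 < \<epsilon>"
          by (auto simp: eventually_at_top_linorder)
      qed
    qed fact
  qed
qed

section \<open>Stability of the origin\<close>

text \<open>The energy \<open>y\<^sup>2 / 2 + x\<^sup>4 / 4\<close> has derivative \<open>\<delta> x\<^sup>2 y\<^sup>2 + y\<^sup>4\<close>, which is positive where \<open>x\<close> is small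
  compared with \<open>y\<close>. Since \<open>(x y\<^sup>3)' = y\<^sup>4 + \<dots>\<close>, subtracting \<open>2 x y\<^sup>3\<close> reverses the sign of \<open>y\<^sup>4\<close>, and
  since \<open>(x\<^sup>3 y)' = - x\<^sup>6 + 3 x\<^sup>2 y\<^sup>2 + \<dots>\<close>, adding a small multiple of \<open>x\<^sup>3 y\<close> gives negativity on
  \<open>y = 0\<close> too. With \<open>b = - \<delta> / 6\<close> half of the good term \<open>\<delta> x\<^sup>2 y\<^sup>2\<close> survives, and all remaining terms are small
  multiples of \<open>x\<^sup>2 y\<^sup>2\<close>, \<open>y\<^sup>4\<close> and \<open>x\<^sup>6\<close> near the origin.\<close>

lemma origin_asymptotically_stable:
  assumes "\<delta> < 0"
  shows "asymptotically_stable (system \<delta>) 0"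
proof -
  define D where "D = - \<delta>"
  have D: "D > 0" "\<delta> = - D" using assms by (auto simp: D_def)
  define b where "b = D / 6"
  have b: "b > 0" "D = 6 * b" using D by (auto simp: b_def)
  define V :: "plane \<Rightarrow> real" where
    "V p = snd p ^ 2 / 2 + fst p ^ 4 / 4 - 2 * fst p * snd p ^ 3 + b * fst p ^ 3 * snd p" for p
  define V' :: "plane \<Rightarrow> plane \<Rightarrow> real" where
    "V' p h = (fst p ^ 3 - 2 * snd p ^ 3 + 3 * b * fst p ^ 2 * snd p) * fst h
      + (snd p - 6 * fst p * snd p ^ 2 + b * fst p ^ 3) * snd h" for p h
  define r where "r = min (1 / 16) (min (b / 64) (1 / (16 * b)))"
  have r: "r > 0" using b by (auto simp: r_def add_nonneg_pos)
  have smalls: "r \<le> 1 / 16" "r \<le> b / 64" "r \<le> 1 / (16 * b)" by (auto simp: r_def)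
  have comps: "\<bar>x\<bar> \<le> r" "\<bar>y\<bar> \<le> r" if "(x, y) \<in> cball 0 r" for x y :: real
    using that norm_fst_le[of x y] norm_snd_le[of y x] by simp_all
  show ?thesis
  proof (rule strict_Lyapunov_function_imp_asymptotically_stable[of _ r V V'])
    show "system \<delta> 0 = 0" by (simp add: system_def zero_prod_def)
    show "(V has_derivative V' p) (at p)" for p
      unfolding V_def V'_def
      by (auto intro!: derivative_eq_intros simp: fun_eq_iff algebra_simps power2_eq_square power3_eq_cube)
    show "continuous_on UNIV (\<lambda>p. V' p (system \<delta> p))"
      unfolding V'_def system_def by (auto simp: case_prod_unfold intro!: continuous_intros)
    show "V 0 = 0" by (simp add: V_def)
  next
    fix p :: plane assume p: "p \<in> cball 0 r" "p \<noteq> 0"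
    obtain x y where xy: "p = (x, y)" by (cases p)
    have c: "\<bar>x\<bar> \<le> r" "\<bar>y\<bar> \<le> r" using comps p by (auto simp: xy)
    have nz: "x \<noteq> 0 \<or> y \<noteq> 0" using p xy by (auto simp: zero_prod_def)
    have xyb: "\<bar>x * y\<bar> \<le> 1 / 256"
      using mult_mono[of "\<bar>x\<bar>" "1 / 16" "\<bar>y\<bar>" "1 / 16"] c smalls r by (simp add: abs_mult)
    have t1: "\<bar>2 * x * y ^ 3\<bar> \<le> y\<^sup>2 / 8"
    proof -
      have "\<bar>2 * x * y ^ 3\<bar> = 2 * \<bar>x * y\<bar> * y\<^sup>2" by (simp add: abs_mult power3_eq_cube power2_eq_square)
      also have "\<dots> \<le> 2 * (1 / 256) * y\<^sup>2" using xyb by (intro mult_right_mono) auto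
      finally show ?thesis by simp
    qed
    have bx: "b * \<bar>x\<bar> \<le> 1 / 16"
      using mult_left_mono[of "\<bar>x\<bar>" "1 / (16 * b)" b] c smalls b by simp
    have t2: "\<bar>b * x ^ 3 * y\<bar> \<le> (x ^ 4 + y\<^sup>2) / 32"
    proof -
      have "\<bar>x\<^sup>2 * y\<bar> \<le> (x ^ 4 + y\<^sup>2) / 2"
        using sum_squares_bound[of "x\<^sup>2" "\<bar>y\<bar>"] by (simp add: abs_mult power2_eq_square power4_eq_xxxx mult.assoc)
      with bx have "(b * \<bar>x\<bar>) * \<bar>x\<^sup>2 * y\<bar> \<le> (1 / 16) * ((x ^ 4 + y\<^sup>2) / 2)"
        by (intro mult_mono) (use b in auto)
      then show ?thesis using b by (simp add: abs_mult power3_eq_cube power2_eq_square mult.assoc)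
    qed
    have "V p \<ge> y\<^sup>2 / 4 + x ^ 4 / 8" using t1 t2 by (simp add: V_def xy) 
    moreover have "y\<^sup>2 / 4 + x ^ 4 / 8 > 0" using nz by (auto intro: add_pos_nonneg add_nonneg_pos)
    ultimately show "0 < V p" by linarith
    \<comment> \<open>the three definite terms come first, the others are absorbed by them one by one below\<close>
    have eq: "V' p (system \<delta> p) = - (3 * b * x\<^sup>2 * y\<^sup>2) - y ^ 4 - b * x ^ 6
        + 6 * x\<^sup>2 * (x\<^sup>2 * y\<^sup>2) + 36 * b * (x * y) * (x\<^sup>2 * y\<^sup>2) - 6 * (x * y) * y ^ 4
        - 6 * b\<^sup>2 * x ^ 5 * y + b * (x * y) * (x\<^sup>2 * y\<^sup>2)"
      unfolding V'_def xy system_def D b fst_conv snd_conv case_prod_conv by algebra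
    have A: "k * (x\<^sup>2 * y\<^sup>2) \<le> l * (x\<^sup>2 * y\<^sup>2)" if "k \<le> l" for k l
      using that by (intro mult_right_mono) auto
    have "6 * x\<^sup>2 \<le> b / 2"
      using mult_mono[of "\<bar>x\<bar>" "b / 64" "\<bar>x\<bar>" 1] c smalls b by (simp add: power2_eq_square)
    then have e1: "6 * x\<^sup>2 * (x\<^sup>2 * y\<^sup>2) \<le> b / 2 * (x\<^sup>2 * y\<^sup>2)" by (rule A)
    have xyb': "b * (x * y) \<le> b * (1 / 256)" using b xyb by (intro mult_left_mono) auto
    have e2: "36 * b * (x * y) * (x\<^sup>2 * y\<^sup>2) \<le> b / 2 * (x\<^sup>2 * y\<^sup>2)"
      by (rule A) (use xyb' b in linarith)
    have e3: "b * (x * y) * (x\<^sup>2 * y\<^sup>2) \<le> b / 2 * (x\<^sup>2 * y\<^sup>2)"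
      by (rule A) (use xyb' b in linarith)
    have e4: "- 6 * (x * y) * y ^ 4 \<le> 1 / 2 * y ^ 4"
      using xyb by (intro mult_right_mono) auto
    have "(b * \<bar>x\<bar>) * (b * \<bar>x\<bar>) \<le> (1 / 16) * (1 / 16)"
      using bx b by (intro mult_mono) auto
    then have "18 * b * (b\<^sup>2 * x\<^sup>2) \<le> 18 * b * (1 / 256)"
      using b by (intro mult_left_mono) (auto simp: power2_eq_square algebra_simps)
    then have "18 * b ^ 3 * x\<^sup>2 \<le> b / 2"
      using b by (simp add: power2_eq_square power3_eq_cube mult.assoc)
    then have e5: "18 * b ^ 3 * x\<^sup>2 * (x\<^sup>2 * y\<^sup>2) \<le> b / 2 * (x\<^sup>2 * y\<^sup>2)" by (rule A)
    have "b / 2 * x ^ 6 + 18 * b ^ 3 * x\<^sup>2 * (x\<^sup>2 * y\<^sup>2) + 6 * b\<^sup>2 * x ^ 5 * y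
        = b / 2 * (x ^ 3 + 6 * b * x\<^sup>2 * y)\<^sup>2"
      by algebra
    moreover have "0 \<le> b / 2 * (x ^ 3 + 6 * b * x\<^sup>2 * y)\<^sup>2" using b by simp
    ultimately have e6: "- 6 * b\<^sup>2 * x ^ 5 * y \<le> b / 2 * x ^ 6 + 18 * b ^ 3 * x\<^sup>2 * (x\<^sup>2 * y\<^sup>2)"
      by linarith
    have "V' p (system \<delta> p) \<le> - (y ^ 4 / 2) - b / 2 * x ^ 6 - b * (x\<^sup>2 * y\<^sup>2)"
      using e1 e2 e3 e4 e5 e6 unfolding eq by linarith
    moreover have "y ^ 4 / 2 + b / 2 * x ^ 6 > 0"
      using nz b by (auto intro: add_pos_nonneg add_nonneg_pos)
    moreover have "b * (x\<^sup>2 * y\<^sup>2) \<ge> 0" using b by simp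
    ultimately show "V' p (system \<delta> p) < 0" by linarith
  qed (fact r)
qed

section \<open>Orbits of the compactified flow\<close>

lemma lipschitz_solutions_unique:
  fixes F :: "'a::real_inner \<Rightarrow> 'a"
  assumes F: "L-lipschitz_on X F" and S: "is_interval S" "a \<in> S" "b \<in> S"
    and \<alpha>: "solves_on F \<alpha> S" "\<alpha> ` S \<subseteq> X" and \<beta>: "solves_on F \<beta> S" "\<beta> ` S \<subseteq> X"
    and "\<alpha> a = \<beta> a"
  shows "\<alpha> b = \<beta> b"
proof -
  define s where "s t = (\<alpha> t - \<beta> t) \<bullet> (\<alpha> t - \<beta> t)" for t
  have "s b = 0"
  proof (rule linear_differential_inequality_zero[OF S])
    show "s a = 0" using assms by (simp add: s_def)
  next
    fix t assume t: "t \<in> S"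
    have "(\<alpha> has_vector_derivative F (\<alpha> t)) (at t within S)" "(\<beta> has_vector_derivative F (\<beta> t)) (at t within S)"
      using \<alpha> \<beta> t by (auto simp: solves_on_def)
    from has_vector_derivative_diff[OF this]
    have "((\<lambda>t. \<alpha> t - \<beta> t) has_derivative (\<lambda>h. h *\<^sub>R (F (\<alpha> t) - F (\<beta> t)))) (at t within S)"
      by (simp add: has_vector_derivative_def)
    from has_derivative_inner[OF this this]
    show "(s has_real_derivative 2 * ((\<alpha> t - \<beta> t) \<bullet> (F (\<alpha> t) - F (\<beta> t)))) (at t within S)"
      unfolding s_def[abs_def] has_field_derivative_def
      by (rule has_derivative_eq_rhs) (simp add: fun_eq_iff inner_commute)
    have "\<bar>(\<alpha> t - \<beta> t) \<bullet> (F (\<alpha> t) - F (\<beta> t))\<bar> \<le> norm (\<alpha> t - \<beta> t) * norm (F (\<alpha> t) - F (\<beta> t))"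
      by (rule Cauchy_Schwarz_ineq2)
    also have "\<dots> \<le> norm (\<alpha> t - \<beta> t) * (L * norm (\<alpha> t - \<beta> t))"
      using \<alpha> \<beta> t lipschitz_onD[OF F, of "\<alpha> t" "\<beta> t"] by (intro mult_left_mono) (auto simp: dist_norm)
    finally show "\<bar>2 * ((\<alpha> t - \<beta> t) \<bullet> (F (\<alpha> t) - F (\<beta> t)))\<bar> \<le> 2 * L * \<bar>s t\<bar>"
      by (simp add: s_def dot_square_norm power2_eq_square abs_mult mult.left_commute)
  qed
  then show ?thesis by (simp add: s_def)
qed

lemma closest_point_cball_outside:
  fixes x :: "'a::euclidean_space"
  assumes "1 < norm x"
  shows "closest_point (cball 0 1) x = x /\<^sub>R norm x"
proof (rule closest_point_unique[symmetric])
  have "x \<noteq> 0" using assms by auto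
  then show "x /\<^sub>R norm x \<in> cball 0 1" by simp
  have "dist x (x /\<^sub>R norm x) = norm ((1 - 1 / norm x) *\<^sub>R x)"
    by (simp add: dist_norm algebra_simps inverse_eq_divide)
  also have "\<dots> = \<bar>1 - 1 / norm x\<bar> * norm x" by (rule norm_scaleR)
  also have "\<bar>1 - 1 / norm x\<bar> = 1 - 1 / norm x" using assms by (intro abs_of_nonneg) (simp add: divide_le_eq_1)
  also have "(1 - 1 / norm x) * norm x = norm x - 1" using \<open>x \<noteq> 0\<close> by (simp add: left_diff_distrib)
  finally have d: "dist x (x /\<^sub>R norm x) = norm x - 1" .
  show "\<forall>z\<in>cball 0 1. dist x (x /\<^sub>R norm x) \<le> dist x z"
  proof
    fix z :: 'a assume "z \<in> cball 0 1"
    then show "dist x (x /\<^sub>R norm x) \<le> dist x z"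
      using norm_triangle_ineq2[of x z] unfolding d by (simp add: dist_norm)
  qed
qed auto

text \<open>The field is precomposed with the nearest point projection onto the unit ball, which makes it globally
  Lipschitz without changing it on the ball. Outside the ball the new field is orthogonal to the position
  vector, so along its solutions \<open>1 - norm\<^sup>2\<close> satisfies a linear differential inequality everywhere, and
  solutions that start on the sphere never leave it.\<close>

theorem sphere_tangent_field_global_solution:
  fixes F :: "'a::euclidean_space \<Rightarrow> 'a"
  assumes F: "L-lipschitz_on (cball 0 1) F"
    and tangent: "\<And>x. norm x \<le> 1 \<Longrightarrow> \<bar>x \<bullet> F x\<bar> \<le> C * (1 - x \<bullet> x)"
    and x0: "norm x0 = 1"
  shows "\<exists>\<gamma>. \<gamma> 0 = x0 \<and> solves_on F \<gamma> {0..} \<and> (\<forall>t\<ge>0. norm (\<gamma> t) = 1)"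
proof -
  define G where "G x = F (closest_point (cball 0 1) x)" for x
  have proj: "closest_point (cball 0 1) x \<in> cball 0 1" for x :: 'a
    by (intro closest_point_in_set) auto
  have "1-lipschitz_on UNIV (closest_point (cball (0::'a) 1))"
    by (rule lipschitz_onI) (use closest_point_lipschitz[of "cball (0::'a) 1"] in auto)
  moreover have "L-lipschitz_on (range (closest_point (cball (0::'a) 1))) F"
    by (rule lipschitz_on_subset[OF F]) (use proj in auto)
  ultimately have "(L * 1)-lipschitz_on UNIV G"
    unfolding G_def by (rule lipschitz_on_compose2)
  from lipschitz_field_global_solution[OF this, of x0]
  obtain \<gamma> where \<gamma>: "\<gamma> 0 = x0" "solves_on G \<gamma> {0..}" by blast
  have G_in: "G x = F x" if "norm x \<le> 1" for x
    using that closest_point_self[of x "cball 0 1"] by (simp add: G_def)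
  have C: "0 \<le> C" using tangent[of 0] by simp
  have rad: "\<bar>x \<bullet> G x\<bar> \<le> C * \<bar>1 - x \<bullet> x\<bar>" for x
  proof (cases "norm x \<le> 1")
    case True
    then have "x \<bullet> x \<le> 1" by (simp add: dot_square_norm power_le_one)
    then show ?thesis using tangent[OF True] True by (simp add: G_in)
  next
    case False
    define u where "u = x /\<^sub>R norm x"
    have u: "norm u = 1" "x = norm x *\<^sub>R u" using False by (cases "x = 0"; simp add: u_def)+
    have "u \<bullet> F u = 0" using tangent[of u] u by (simp add: dot_square_norm)
    moreover have "G x = F u"
      using False by (simp add: G_def u_def closest_point_cball_outside)
    ultimately have "x \<bullet> G x = 0" by (metis inner_scaleR_left mult_zero_right u(2))
    then show ?thesis using C by simp
  qed
  have unit: "norm (\<gamma> t) = 1" if t: "0 \<le> t" for t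
  proof -
    have "1 - \<gamma> t \<bullet> \<gamma> t = 0"
    proof (rule linear_differential_inequality_zero[where s = "\<lambda>t. 1 - \<gamma> t \<bullet> \<gamma> t" and S = "{0..}" and a = 0])
      show "1 - \<gamma> 0 \<bullet> \<gamma> 0 = 0" using x0 \<gamma> by (simp add: dot_square_norm)
    next
      fix t :: real assume "t \<in> {0..}"
      moreover have "((\<lambda>x. 1 - x \<bullet> x) has_derivative (\<lambda>h. - 2 * (\<gamma> t \<bullet> h))) (at (\<gamma> t))"
        by (auto intro!: derivative_eq_intros simp: inner_commute)
      ultimately show "((\<lambda>t. 1 - \<gamma> t \<bullet> \<gamma> t) has_real_derivative - 2 * (\<gamma> t \<bullet> G (\<gamma> t))) (at t within {0..})"
        by (rule solves_on_has_real_derivative[OF \<gamma>(2)])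
      show "\<bar>- 2 * (\<gamma> t \<bullet> G (\<gamma> t))\<bar> \<le> 2 * C * \<bar>1 - \<gamma> t \<bullet> \<gamma> t\<bar>"
        using rad[of "\<gamma> t"] by (simp add: abs_mult)
    qed (use t in \<open>auto simp: is_interval_ci\<close>)
    then have "(norm (\<gamma> t))\<^sup>2 = 1" by (simp add: dot_square_norm)
    then show ?thesis using norm_ge_zero[of "\<gamma> t"] unfolding power2_eq_1_iff by linarith
  qed
  have "solves_on F \<gamma> {0..}"
    using \<gamma>(2) unit by (auto simp: solves_on_def G_in)
  then show ?thesis using \<gamma> unit by blast
qed

lemma solves_on_reverse:
  assumes "solves_on (\<lambda>x. - F x) \<gamma> {0..}"
  shows "solves_on F (\<lambda>t. \<gamma> (- t)) {..0}"
  unfolding solves_on_def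
proof
  fix t :: real assume t: "t \<in> {..0}"
  have "(\<gamma> has_vector_derivative - F (\<gamma> (- t))) (at (- t) within uminus ` {..0})"
    using assms t by (auto simp: solves_on_def image_uminus_atMost)
  from vector_diff_chain_within[OF has_vector_derivative_minus[OF has_vector_derivative_id] this]
  show "((\<lambda>t. \<gamma> (- t)) has_vector_derivative F (\<gamma> (- t))) (at t within {..0})"
    by (simp add: o_def)
qed

lemma lipschitz_on_bounded_mult:
  fixes f g :: "'a::heine_borel \<Rightarrow> real"
  assumes "bounded U" and f: "\<exists>L. L-lipschitz_on U f" and g: "\<exists>L. L-lipschitz_on U g"
  shows "\<exists>L. L-lipschitz_on U (\<lambda>x. f x * g x)"
proof -
  obtain L M where LM: "L-lipschitz_on U f" "M-lipschitz_on U g" using f g by blast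
  have "bounded (f ` U)" "bounded (g ` U)"
    using LM \<open>bounded U\<close> by (auto intro: bounded_uniformly_continuous_image lipschitz_on_uniformly_continuous)
  then obtain A B where AB: "\<And>x. x \<in> U \<Longrightarrow> \<bar>f x\<bar> \<le> A" "\<And>x. x \<in> U \<Longrightarrow> \<bar>g x\<bar> \<le> B" "A > 0" "B > 0"
    unfolding bounded_pos by (auto simp: )
  have nonneg: "0 \<le> L" "0 \<le> M" using LM by (auto intro: lipschitz_on_nonneg)
  have "(A * M + L * B)-lipschitz_on U (\<lambda>x. f x * g x)"
  proof (rule lipschitz_onI)
    fix x y assume xy: "x \<in> U" "y \<in> U"
    have "f x * g x - f y * g y = f x * (g x - g y) + (f x - f y) * g y" by (simp add: algebra_simps)
    also have "\<bar>\<dots>\<bar> \<le> \<bar>f x\<bar> * \<bar>g x - g y\<bar> + \<bar>f x - f y\<bar> * \<bar>g y\<bar>"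
      by (metis abs_mult abs_triangle_ineq)
    also have "\<dots> \<le> A * (M * dist x y) + (L * dist x y) * B"
      using lipschitz_onD[OF LM(1) xy] lipschitz_onD[OF LM(2) xy] AB xy nonneg
      by (intro add_mono mult_mono) (auto simp: dist_real_def)
    finally show "dist (f x * g x) (f y * g y) \<le> (A * M + L * B) * dist x y"
      by (simp add: dist_real_def algebra_simps)
  qed (use AB nonneg in auto)
  then show ?thesis by blast
qed

text \<open>The common factor \<open>r\<close> of the compactified system: the component of the homogenized field along the position
  vector.\<close>

definition radial_speed :: "real \<Rightarrow> space \<Rightarrow> real" where
  "radial_speed \<delta> = (\<lambda>(X, Y, Z). X * Y * Z\<^sup>2 + Y * (- (X ^ 3) + \<delta> * X\<^sup>2 * Y + Y ^ 3))"

lemma compactified_system: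
  "compactified_field 3 (system \<delta>) (X, Y, Z) =
     (Y * Z\<^sup>2 - X * radial_speed \<delta> (X, Y, Z),
      - (X ^ 3) + \<delta> * X\<^sup>2 * Y + Y ^ 3 - Y * radial_speed \<delta> (X, Y, Z),
      - Z * radial_speed \<delta> (X, Y, Z))"
  by (simp add: compactified_field_def homogenize_system Let_def radial_speed_def mult.assoc)

lemma lipschitz_combination_intros:
  fixes f g :: "'a::metric_space \<Rightarrow> 'b::real_normed_vector" and h :: "'a \<Rightarrow> 'c::metric_space"
  shows "\<exists>L. L-lipschitz_on U f \<Longrightarrow> \<exists>L. L-lipschitz_on U g \<Longrightarrow> \<exists>L. L-lipschitz_on U (\<lambda>x. f x + g x)"
    and "\<exists>L. L-lipschitz_on U f \<Longrightarrow> \<exists>L. L-lipschitz_on U g \<Longrightarrow> \<exists>L. L-lipschitz_on U (\<lambda>x. f x - g x)"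
    and "\<exists>L. L-lipschitz_on U f \<Longrightarrow> \<exists>L. L-lipschitz_on U (\<lambda>x. - f x)"
    and "\<exists>L. L-lipschitz_on U f \<Longrightarrow> \<exists>L. L-lipschitz_on U h \<Longrightarrow> \<exists>L. L-lipschitz_on U (\<lambda>x. (f x, h x))"
    and "\<exists>L. L-lipschitz_on U (\<lambda>x. c :: 'b)"
  by (blast intro: lipschitz_intros)+

text \<open>The field is polynomial, so on a bounded set it is a combination of bounded Lipschitz functions. Powers are
  written out as products to match the rules.\<close>

lemma lipschitz_compactified_system: "\<exists>L. L-lipschitz_on (cball 0 1) (compactified_field 3 (system \<delta>))"
proof -
  let ?U = "cball (0::space) 1"
  have b: "bounded ?U" by simp
  have X: "\<exists>L. L-lipschitz_on ?U fst"
    by (intro exI[of _ 1] lipschitz_onI) (auto simp: dist_fst_le)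
  have Y: "\<exists>L. L-lipschitz_on ?U (\<lambda>p. fst (snd p))"
    by (intro exI[of _ 1] lipschitz_onI) (auto intro: order_trans[OF dist_fst_le dist_snd_le])
  have Z: "\<exists>L. L-lipschitz_on ?U (\<lambda>p. snd (snd p))"
    by (intro exI[of _ 1] lipschitz_onI) (auto intro: order_trans[OF dist_snd_le dist_snd_le])
  have eq: "compactified_field 3 (system \<delta>) = (\<lambda>p.
     let X = fst p; Y = fst (snd p); Z = snd (snd p);
       r = X * Y * (Z * Z) + Y * (- (X * X * X) + \<delta> * (X * X) * Y + Y * Y * Y)
     in (Y * (Z * Z) - X * r, - (X * X * X) + \<delta> * (X * X) * Y + Y * Y * Y - Y * r, - (Z * r)))"
    by (auto simp: fun_eq_iff Let_def compactified_system radial_speed_def power2_eq_square power3_eq_cube mult.assoc)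
  show ?thesis
    unfolding eq Let_def
    by (intro lipschitz_combination_intros lipschitz_on_bounded_mult[OF b] X Y Z)
qed

lemma radial_speed_bounded: "\<exists>C. \<forall>p\<in>cball 0 1. \<bar>radial_speed \<delta> p\<bar> \<le> C"
proof -
  have "continuous_on (cball 0 1) (radial_speed \<delta>)"
    unfolding radial_speed_def case_prod_unfold by (intro continuous_intros)
  then have "bounded (radial_speed \<delta> ` cball 0 1)"
    by (intro compact_imp_bounded compact_continuous_image compact_cball)
  then show ?thesis by (auto simp: bounded_iff)
qed

lemma inner_compactified_system:
  "p \<bullet> compactified_field 3 (system \<delta>) p = radial_speed \<delta> p * (1 - p \<bullet> p)"
proof -
  obtain X Y Z where p: "p = (X, Y, Z)" by (cases p) auto
  have "radial_speed \<delta> p = X * (Y * Z\<^sup>2) + Y * (- (X ^ 3) + \<delta> * X\<^sup>2 * Y + Y ^ 3)"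
    by (simp add: p radial_speed_def)
  then show ?thesis
    unfolding p compactified_system inner_Pair inner_real_def by algebra
qed

lemma hemisphere_iff: "p \<in> hemisphere \<longleftrightarrow> norm p = 1 \<and> 0 \<le> snd (snd p)"
  by (cases p) (auto simp: hemisphere_def norm_Pair)

text \<open>The height \<open>Z\<close> satisfies the linear equation \<open>Z' = - r Z\<close>.\<close>

lemma equator_invariant:
  assumes sol: "solves_on (compactified_field 3 (system \<delta>)) \<gamma> S" and S: "is_interval S" "a \<in> S" "b \<in> S"
    and unit: "\<And>t. t \<in> S \<Longrightarrow> norm (\<gamma> t) = 1" and "snd (snd (\<gamma> a)) = 0"
  shows "snd (snd (\<gamma> b)) = 0"
proof -
  obtain C where C: "\<And>p. p \<in> cball 0 1 \<Longrightarrow> \<bar>radial_speed \<delta> p\<bar> \<le> C"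
    using radial_speed_bounded by blast
  show ?thesis
  proof (rule linear_differential_inequality_zero[OF S, where s = "\<lambda>t. snd (snd (\<gamma> t))"])
    fix t assume t: "t \<in> S"
    have "snd (snd (compactified_field 3 (system \<delta>) p)) = - snd (snd p) * radial_speed \<delta> p" for p
      by (cases p) (auto simp: compactified_system)
    moreover have "((\<lambda>p. snd (snd p)) has_derivative (\<lambda>h. snd (snd h))) (at (\<gamma> t))"
      by (intro has_derivative_snd has_derivative_ident)
    note solves_on_has_real_derivative[OF sol t this]
    ultimately show "((\<lambda>t. snd (snd (\<gamma> t))) has_real_derivative
        - snd (snd (\<gamma> t)) * radial_speed \<delta> (\<gamma> t)) (at t within S)" by simp
    show "\<bar>- snd (snd (\<gamma> t)) * radial_speed \<delta> (\<gamma> t)\<bar> \<le> C * \<bar>snd (snd (\<gamma> t))\<bar>"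
      using mult_right_mono[OF C[of "\<gamma> t"], of "\<bar>snd (snd (\<gamma> t))\<bar>"] unit[OF t]
      by (simp add: abs_mult mult.commute)
  qed fact
qed

lemma hemisphere_invariant:
  assumes sol: "solves_on (compactified_field 3 (system \<delta>)) \<gamma> S" and S: "is_interval S" "a \<in> S"
    and unit: "\<And>t. t \<in> S \<Longrightarrow> norm (\<gamma> t) = 1" and a: "\<gamma> a \<in> hemisphere"
  shows "\<gamma> ` S \<subseteq> hemisphere"
proof -
  have "0 \<le> snd (snd (\<gamma> b))" if b: "b \<in> S" for b
  proof (rule ccontr)
    assume neg: "\<not> ?thesis"
    have cont: "continuous_on S (\<lambda>t. snd (snd (\<gamma> t)))"
      by (intro continuous_intros solves_on_continuous_on[OF sol])
    have "connected ((\<lambda>t. snd (snd (\<gamma> t))) ` S)"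
      using S cont by (simp add: connected_continuous_image is_interval_connected)
    then have "0 \<in> (\<lambda>t. snd (snd (\<gamma> t))) ` S"
      by (rule connectedD_interval[of _ "snd (snd (\<gamma> b))" "snd (snd (\<gamma> a))"])
        (use neg a b S in \<open>auto simp: hemisphere_iff\<close>)
    then obtain c where c: "c \<in> S" "snd (snd (\<gamma> c)) = 0" by force
    have "snd (snd (\<gamma> b)) = 0" by (rule equator_invariant[OF sol S(1) c(1) b unit c(2)])
    then show False using neg by simp
  qed
  then show ?thesis using unit by (simp add: image_subset_iff hemisphere_iff)
qed

proposition hemisphere_orbits_exist:
  assumes x0: "x0 \<in> hemisphere"
  shows "\<exists>\<gamma>. \<gamma> 0 = x0 \<and> solves_on (compactified_field 3 (system \<delta>)) \<gamma> {0..} \<and> \<gamma> ` {0..} \<subseteq> hemisphere"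
    and "\<exists>\<gamma>. \<gamma> 0 = x0 \<and> solves_on (compactified_field 3 (system \<delta>)) \<gamma> {..0} \<and> \<gamma> ` {..0} \<subseteq> hemisphere"
proof -
  let ?F = "compactified_field 3 (system \<delta>)"
  obtain C where C: "\<And>p. p \<in> cball 0 1 \<Longrightarrow> \<bar>radial_speed \<delta> p\<bar> \<le> C"
    using radial_speed_bounded by blast
  have tangent: "\<bar>p \<bullet> ?F p\<bar> \<le> C * (1 - p \<bullet> p)" if "norm p \<le> 1" for p
  proof -
    have "p \<bullet> p \<le> 1" using that by (simp add: dot_square_norm power_le_one)
    then show ?thesis
      using C[of p] that by (simp add: inner_compactified_system abs_mult mult_right_mono)
  qed
  obtain L where L: "L-lipschitz_on (cball 0 1) ?F" using lipschitz_compactified_system by blast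
  have n0: "norm x0 = 1" using x0 by (simp add: hemisphere_iff)
  obtain \<gamma> where \<gamma>: "\<gamma> 0 = x0" "solves_on ?F \<gamma> {0..}" "\<And>t. 0 \<le> t \<Longrightarrow> norm (\<gamma> t) = 1"
    using sphere_tangent_field_global_solution[OF L tangent n0] by blast
  moreover have "\<gamma> ` {0..} \<subseteq> hemisphere"
    by (rule hemisphere_invariant[OF \<gamma>(2), of 0]) (use \<gamma> x0 in \<open>auto simp: is_interval_ci\<close>)
  ultimately show "\<exists>\<gamma>. \<gamma> 0 = x0 \<and> solves_on ?F \<gamma> {0..} \<and> \<gamma> ` {0..} \<subseteq> hemisphere"
    by blast
  have L': "L-lipschitz_on (cball 0 1) (\<lambda>p. - ?F p)" using L by simp
  have tangent': "\<bar>p \<bullet> - ?F p\<bar> \<le> C * (1 - p \<bullet> p)" if "norm p \<le> 1" for p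
    using tangent[OF that] by simp
  obtain \<beta> where \<beta>: "\<beta> 0 = x0" "solves_on (\<lambda>p. - ?F p) \<beta> {0..}" "\<And>t. 0 \<le> t \<Longrightarrow> norm (\<beta> t) = 1"
    using sphere_tangent_field_global_solution[OF L' tangent' n0] by blast
  have \<beta>': "solves_on ?F (\<lambda>t. \<beta> (- t)) {..0}" using \<beta>(2) by (rule solves_on_reverse)
  moreover have "(\<lambda>t. \<beta> (- t)) ` {..0} \<subseteq> hemisphere"
    by (rule hemisphere_invariant[OF \<beta>', of 0]) (use \<beta> x0 in \<open>auto simp: is_interval_ic\<close>)
  ultimately show "\<exists>\<gamma>. \<gamma> 0 = x0 \<and> solves_on ?F \<gamma> {..0} \<and> \<gamma> ` {..0} \<subseteq> hemisphere"
    using \<beta>(1) by (intro exI[of _ "\<lambda>t. \<beta> (- t)"]) auto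
qed

section \<open>The transversal hyperbola\<close>

text \<open>The factors vanish on the asymptotes, whose slopes are \<open>- 1 / 2\<close> and \<open>2\<close>. The cone where the form is
  positive contains the vertical direction, which is a sink at infinity. The slopes and the level \<open>5\<close> are
  chosen so that the quartic form in \<open>orbital_deriv_pos_on_hyperbola\<close> is positive on that cone.\<close>

definition hyperbola_form :: "plane \<Rightarrow> real" where
  "hyperbola_form = (\<lambda>(x, y). 3 * (x + 2 * y) * (y - 2 * x))"

definition hyperbola_fn :: "plane \<Rightarrow> real" where
  "hyperbola_fn p = hyperbola_form p - 5"

definition central_region :: "plane set" where
  "central_region = {p. hyperbola_fn p < 0} - {0}"

lemma hyperbola_fn_0: "hyperbola_fn 0 = - 5"
  by (simp add: hyperbola_fn_def hyperbola_form_def zero_prod_def)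

lemma hyperbola_form_scaleR: "hyperbola_form (c *\<^sub>R p) = c\<^sup>2 * hyperbola_form p"
  by (cases p) (simp add: hyperbola_form_def power2_eq_square algebra_simps)

lemma continuous_on_hyperbola_form: "continuous_on S hyperbola_form"
  unfolding hyperbola_form_def case_prod_unfold by (intro continuous_intros)

lemma continuous_on_hyperbola_fn: "continuous_on S hyperbola_fn"
  unfolding hyperbola_fn_def[abs_def] by (intro continuous_intros continuous_on_hyperbola_form)

lemma hyperbola_poly_hyperbola_fn: "hyperbola_poly hyperbola_fn"
  unfolding hyperbola_poly_def
proof (intro exI conjI)
  show "hyperbola_fn = (\<lambda>(x, y). (- 6) * x ^ 2 + (- 9) * x * y + 6 * y ^ 2 + 0 * x + 0 * y + (- 5))"
    by (auto simp: hyperbola_fn_def hyperbola_form_def fun_eq_iff power2_eq_square algebra_simps)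
qed (simp_all add: det_3)

lemma hyperbola_fn_has_derivative:
  "(hyperbola_fn has_derivative (\<lambda>h. (- 9 * y - 12 * x) * fst h + (12 * y - 9 * x) * snd h)) (at (x, y))"
  unfolding hyperbola_fn_def[abs_def] hyperbola_form_def case_prod_unfold
  by (auto intro!: derivative_eq_intros simp: fun_eq_iff algebra_simps)

lemma orbital_deriv_hyperbola_fn:
  "orbital_deriv F hyperbola_fn (x, y) = (- 9 * y - 12 * x) * fst (F (x, y)) + (12 * y - 9 * x) * snd (F (x, y))"
proof -
  have "((\<lambda>s. hyperbola_fn (s, y)) has_real_derivative - 9 * y - 12 * x) (at x)"
    unfolding hyperbola_fn_def hyperbola_form_def by (auto intro!: derivative_eq_intros simp: algebra_simps)
  moreover have "((\<lambda>s. hyperbola_fn (x, s)) has_real_derivative 12 * y - 9 * x) (at y)"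
    unfolding hyperbola_fn_def hyperbola_form_def by (auto intro!: derivative_eq_intros simp: algebra_simps)
  ultimately show ?thesis
    by (simp add: orbital_deriv_def DERIV_imp_deriv mult.commute)
qed

text \<open>On the hyperbola \<open>3 q = 5\<close>, so the quadratic part of the orbital derivative can be multiplied by \<open>3 q / 5\<close>; this
  yields the quartic form \<open>3 G / 5\<close>. The coefficient of \<open>\<delta>\<close> in \<open>G\<close> is \<open>5 x\<^sup>2 (4 y\<^sup>2 - 3 x y)\<close>, nonnegative where
  \<open>q > 0\<close>, so \<open>\<delta> = - 53 / 25\<close> is the worst case.\<close>

lemma orbital_deriv_pos_on_hyperbola:
  assumes \<delta>: "- (53 / 25) \<le> \<delta>" and p: "hyperbola_fn p = 0"
  shows "0 < orbital_deriv (system \<delta>) hyperbola_fn p"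
proof -
  obtain x y where xy: "p = (x, y)" by (cases p)
  define q where "q = 2 * y\<^sup>2 - 3 * x * y - 2 * x\<^sup>2"
  have q: "3 * q = 5" using p by (simp add: xy hyperbola_fn_def hyperbola_form_def q_def power2_eq_square algebra_simps)
  have nz: "x\<^sup>2 + y\<^sup>2 > 0"
    using q by (cases "x = 0 \<and> y = 0") (auto simp: q_def add_pos_nonneg add_nonneg_pos)
  define G where "G = q * (- 9 * y\<^sup>2 - 12 * x * y) + 5 * (4 * y - 3 * x) * (y ^ 3 + \<delta> * x\<^sup>2 * y - x ^ 3)"
  have "orbital_deriv (system \<delta>) hyperbola_fn p
      = y * (- 9 * y - 12 * x) + (12 * y - 9 * x) * (y ^ 3 + \<delta> * x\<^sup>2 * y - x ^ 3)"
    by (simp add: xy orbital_deriv_hyperbola_fn system_def algebra_simps)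
  then have "5 * orbital_deriv (system \<delta>) hyperbola_fn p = 3 * q * (- 9 * y\<^sup>2 - 12 * x * y)
      + 15 * (4 * y - 3 * x) * (y ^ 3 + \<delta> * x\<^sup>2 * y - x ^ 3)"
    unfolding q by (simp add: algebra_simps power2_eq_square)
  then have 5: "5 * orbital_deriv (system \<delta>) hyperbola_fn p = 3 * G" by (simp add: G_def algebra_simps)
  have "4 * y\<^sup>2 - 3 * x * y = q + 2 * (x\<^sup>2 + y\<^sup>2)" by (simp add: q_def algebra_simps)
  then have "4 * y\<^sup>2 - 3 * x * y \<ge> 0" using q nz by simp
  then have mono: "0 \<le> 5 * x\<^sup>2 * (\<delta> + 53 / 25) * (4 * y\<^sup>2 - 3 * x * y)"
    using \<delta> by (intro mult_nonneg_nonneg) auto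
  \<comment> \<open>a certificate at \<open>\<delta> = - 53 / 25\<close>: the remainder after subtracting \<open>q (x\<^sup>2 + y\<^sup>2) / 10\<close> is a positive definite
    quartic, diagonalised by completing squares\<close>
  have cert: "G = 5 * x\<^sup>2 * (\<delta> + 53 / 25) * (4 * y\<^sup>2 - 3 * x * y)
      + 9 / 5 * (y\<^sup>2 - 13 / 4 * x * y - 25 / 9 * x\<^sup>2)\<^sup>2
      + x\<^sup>2 * (207 / 80 * y\<^sup>2 + 18 / 5 * x * y + 59 / 45 * x\<^sup>2)
      + q / 10 * (x\<^sup>2 + y\<^sup>2)"
    unfolding G_def q_def by (simp add: field_simps power2_eq_square power3_eq_cube)
  have "207 / 80 * y\<^sup>2 + 18 / 5 * x * y + 59 / 45 * x\<^sup>2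
      = 207 / 80 * (y + 16 / 23 * x)\<^sup>2 + (59 / 45 - 144 / 115) * x\<^sup>2"
    by (simp add: field_simps power2_eq_square)
  then have "0 \<le> 207 / 80 * y\<^sup>2 + 18 / 5 * x * y + 59 / 45 * x\<^sup>2" by simp
  then have "0 \<le> x\<^sup>2 * (207 / 80 * y\<^sup>2 + 18 / 5 * x * y + 59 / 45 * x\<^sup>2)" by simp
  moreover have "0 < q / 10 * (x\<^sup>2 + y\<^sup>2)" using q nz by simp
  moreover have "0 \<le> 9 / 5 * (y\<^sup>2 - 13 / 4 * x * y - 25 / 9 * x\<^sup>2)\<^sup>2" by simp
  ultimately have "0 < G" using mono unfolding cert by linarith
  then show ?thesis using 5 by simp
qed

lemma transversal_hyperbola_fn:
  assumes "- (53 / 25) \<le> \<delta>"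
  shows "transversal (system \<delta>) hyperbola_fn"
proof -
  have pos: "0 < orbital_deriv (system \<delta>) hyperbola_fn p" if "p \<in> zero_locus hyperbola_fn" for p
    using orbital_deriv_pos_on_hyperbola[OF assms] that by (simp add: zero_locus_def)
  then have "{p \<in> zero_locus hyperbola_fn. orbital_deriv (system \<delta>) hyperbola_fn p = 0} = {}" by force
  then show ?thesis using pos unfolding transversal_def by (metis finite.emptyI less_imp_le)
qed

text \<open>The quadratic part of the polynomial is homogeneous, so the sublevel set is starlike about the origin; the sign of the
  polynomial separates it from the rest.\<close>

lemma component_of_origin: "connected_component_set (- zero_locus hyperbola_fn) 0 = {p. hyperbola_fn p < 0}"
proof
  have "starlike {p. hyperbola_fn p < 0}"
    unfolding starlike_def
  proof (intro bexI[of _ 0] ballI subsetI)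
    fix p q assume p: "p \<in> {p. hyperbola_fn p < 0}" and "q \<in> closed_segment 0 p"
    then obtain u where u: "0 \<le> u" "u \<le> 1" "q = u *\<^sub>R p" by (auto simp: closed_segment_def)
    have "u\<^sup>2 * hyperbola_form p < 5"
    proof (cases "hyperbola_form p \<le> 0")
      case True
      then have "u\<^sup>2 * hyperbola_form p \<le> 0" by (simp add: mult_nonneg_nonpos)
      then show ?thesis by simp
    next
      case False
      then have "u\<^sup>2 * hyperbola_form p \<le> 1 * hyperbola_form p"
        using u by (intro mult_right_mono) (auto simp: power_le_one)
      then show ?thesis using p by (simp add: hyperbola_fn_def)
    qed
    then show "q \<in> {p. hyperbola_fn p < 0}" by (simp add: u hyperbola_fn_def hyperbola_form_scaleR)
  qed (simp add: hyperbola_fn_0)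
  then have "connected {p. hyperbola_fn p < 0}" by (rule starlike_imp_connected)
  moreover have "0 \<in> {p. hyperbola_fn p < 0}" by (simp add: hyperbola_fn_0)
  moreover have "{p. hyperbola_fn p < 0} \<subseteq> - zero_locus hyperbola_fn" by (auto simp: zero_locus_def)
  ultimately show "{p. hyperbola_fn p < 0} \<subseteq> connected_component_set (- zero_locus hyperbola_fn) 0"
    by (intro connected_component_maximal)
next
  let ?C = "connected_component_set (- zero_locus hyperbola_fn) 0"
  show "?C \<subseteq> {p. hyperbola_fn p < 0}"
  proof
    fix p assume p: "p \<in> ?C"
    have "connected (hyperbola_fn ` ?C)"
      by (rule connected_continuous_image[OF continuous_on_hyperbola_fn connected_connected_component])
    moreover have "0 \<in> - zero_locus hyperbola_fn" by (simp add: zero_locus_def hyperbola_fn_0)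
    then have "hyperbola_fn 0 \<in> hyperbola_fn ` ?C" by (intro imageI) simp
    moreover have "hyperbola_fn p \<in> hyperbola_fn ` ?C" using p by (rule imageI)
    moreover have "0 \<notin> hyperbola_fn ` ?C"
      using connected_component_subset[of "- zero_locus hyperbola_fn" 0] by (fastforce simp: zero_locus_def)
    ultimately have "\<not> 0 \<le> hyperbola_fn p"
      using connectedD_interval[of "hyperbola_fn ` ?C" "hyperbola_fn 0" "hyperbola_fn p" 0] by (auto simp: hyperbola_fn_0)
    then show "p \<in> {p. hyperbola_fn p < 0}" by simp
  qed
qed

text \<open>Along an orbit through the hyperbola the polynomial passes from negative to positive values, because its orbital
  derivative is positive there.\<close>

lemma flow_exits_central_region:
  assumes "- (53 / 25) \<le> \<delta>"
  shows "flow_exits_through (system \<delta>) central_region (zero_locus hyperbola_fn)"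
  unfolding flow_exits_through_def
proof (intro allI impI conjI)
  fix \<epsilon> :: real and \<gamma> assume \<epsilon>: "0 < \<epsilon>" and sol: "solves_on (system \<delta>) \<gamma> {- \<epsilon><..<\<epsilon>}" and 0: "\<gamma> 0 \<in> zero_locus hyperbola_fn"
  have mem: "0 \<in> {- \<epsilon><..<\<epsilon>}" using \<epsilon> by simp
  have at: "at 0 within {- \<epsilon><..<\<epsilon>} = at (0::real)" using \<epsilon> by (intro at_within_open) auto
  obtain x y where xy: "\<gamma> 0 = (x, y)" by (cases "\<gamma> 0")
  have h0: "hyperbola_fn (\<gamma> 0) = 0" using 0 by (simp add: zero_locus_def)
  have "((\<lambda>t. hyperbola_fn (\<gamma> t)) has_real_derivative orbital_deriv (system \<delta>) hyperbola_fn (\<gamma> 0)) (at 0)"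
    using solves_on_has_real_derivative[OF sol mem, unfolded xy, OF hyperbola_fn_has_derivative]
    by (simp add: at xy orbital_deriv_hyperbola_fn)
  note d = this orbital_deriv_pos_on_hyperbola[OF assms h0]
  obtain r where r: "r > 0" "\<And>h. 0 < h \<Longrightarrow> h < r \<Longrightarrow> 0 < hyperbola_fn (\<gamma> h)"
    using DERIV_pos_inc_right[OF d] h0 by auto
  obtain l where l: "l > 0" "\<And>h. 0 < h \<Longrightarrow> h < l \<Longrightarrow> hyperbola_fn (\<gamma> (- h)) < 0"
    using DERIV_pos_inc_left[OF d] h0 by auto
  have "isCont \<gamma> 0"
    using solves_on_continuous_on[OF sol] mem by (simp add: continuous_on_eq_continuous_at)
  then have "(\<gamma> \<longlongrightarrow> \<gamma> 0) (at_left 0)"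
    by (simp add: isCont_def filterlim_at_split)
  moreover have "\<gamma> 0 \<noteq> 0" using h0 by (auto simp: hyperbola_fn_def hyperbola_form_def zero_prod_def)
  ultimately have "\<forall>\<^sub>F t in at_left 0. \<gamma> t \<noteq> 0" by (rule tendsto_imp_eventually_ne)
  moreover have "\<forall>\<^sub>F t in at_left 0. hyperbola_fn (\<gamma> t) < 0"
    unfolding eventually_at_left_field
    by (rule exI[of _ "- l"]) (use l(1) l(2)[of "- t" for t] in auto)
  ultimately show "\<forall>\<^sub>F t in at_left 0. \<gamma> t \<in> central_region"
    by eventually_elim (simp add: central_region_def)
  have "closed {p. hyperbola_fn p \<le> 0}" by (intro closed_Collect_le continuous_on_hyperbola_fn continuous_intros)
  then have cl: "closure central_region \<subseteq> {p. hyperbola_fn p \<le> 0}"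
    by (intro closure_minimal) (auto simp: central_region_def)
  have "\<forall>\<^sub>F t in at_right 0. 0 < hyperbola_fn (\<gamma> t)"
    unfolding eventually_at_right_field using r by auto
  then show "\<forall>\<^sub>F t in at_right 0. \<gamma> t \<notin> closure central_region"
    by eventually_elim (use cl in force)
qed

section \<open>The region in the Poincare disk\<close>

lemma to_disk_eq: "to_disk p = p /\<^sub>R sqrt ((norm p)\<^sup>2 + 1)"
  by (cases p) (simp add: to_disk_def to_hemisphere_def disk_proj_def norm_Pair divide_inverse)

lemma to_disk_image:
  "to_disk ` {p. A p} = {u. norm u < 1 \<and> A (u /\<^sub>R sqrt (1 - (norm u)\<^sup>2))}"
proof (intro equalityI subsetI)
  fix u assume "u \<in> to_disk ` {p. A p}"
  then obtain p where p: "A p" "u = p /\<^sub>R sqrt ((norm p)\<^sup>2 + 1)" by (auto simp: to_disk_eq)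
  define c where "c = sqrt ((norm p)\<^sup>2 + 1)"
  have c: "c > 0" "c\<^sup>2 = (norm p)\<^sup>2 + 1" by (auto simp: c_def add_nonneg_pos)
  have nu: "(norm u)\<^sup>2 = (norm p)\<^sup>2 / c\<^sup>2"
    using c(1) by (simp add: p(2) c_def[symmetric] power_mult_distrib power_inverse divide_inverse)
  then have "1 - (norm u)\<^sup>2 = (c\<^sup>2 - (norm p)\<^sup>2) / c\<^sup>2" using c(1) by (simp add: diff_divide_distrib)
  then have "1 - (norm u)\<^sup>2 = (1 / c)\<^sup>2" using c(2) by (simp add: power_divide)
  then have "sqrt (1 - (norm u)\<^sup>2) = 1 / c" using c(1) by simp
  moreover have "(norm p)\<^sup>2 < c\<^sup>2" using c(2) by simp
  then have "(norm u)\<^sup>2 < 1\<^sup>2" unfolding nu using c(1) by simp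
  then have "norm u < 1" by (rule power_less_imp_less_base) simp
  ultimately show "u \<in> {u. norm u < 1 \<and> A (u /\<^sub>R sqrt (1 - (norm u)\<^sup>2))}"
    using p c(1) by (simp add: c_def[symmetric])
next
  fix u assume u: "u \<in> {u. norm u < 1 \<and> A (u /\<^sub>R sqrt (1 - (norm u)\<^sup>2))}"
  define c where "c = sqrt (1 - (norm u)\<^sup>2)"
  have "(norm u)\<^sup>2 < 1" using u by (simp add: power_less_one_iff abs_square_less_1)
  then have c: "c > 0" "c\<^sup>2 = 1 - (norm u)\<^sup>2" by (auto simp: c_def)
  have "(norm (u /\<^sub>R c))\<^sup>2 + 1 = (1 / c)\<^sup>2"
    using c by (simp add: power_mult_distrib power_inverse field_simps)
  then have "to_disk (u /\<^sub>R c) = u" using c(1) by (simp add: to_disk_eq)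
  then show "u \<in> to_disk ` {p. A p}" using u by (force simp: c_def)
qed

text \<open>The inverse of the embedding into the disk sends \<open>u\<close> to \<open>u / sqrt (1 - norm\<^sup>2)\<close>. Clearing the denominator
  describes the region by an inequality that makes sense up to the equator, where it becomes
  \<open>hyperbola_form u \<le> 0\<close>.\<close>

lemma hyperbola_fn_preimage_iff:
  assumes "norm u < 1"
  shows "hyperbola_fn (u /\<^sub>R sqrt (1 - (norm u)\<^sup>2)) < 0 \<longleftrightarrow> hyperbola_form u + 5 * (norm u)\<^sup>2 < 5"
    and "hyperbola_fn (u /\<^sub>R sqrt (1 - (norm u)\<^sup>2)) = 0 \<longleftrightarrow> hyperbola_form u + 5 * (norm u)\<^sup>2 = 5"
proof -
  have "(norm u)\<^sup>2 < 1" using assms by (simp add: abs_square_less_1)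
  then have pos: "1 - (norm u)\<^sup>2 > 0" by simp
  then have eq: "hyperbola_fn (u /\<^sub>R sqrt (1 - (norm u)\<^sup>2)) = hyperbola_form u / (1 - (norm u)\<^sup>2) - 5"
    by (simp add: hyperbola_fn_def hyperbola_form_scaleR power_inverse divide_inverse)
  show "hyperbola_fn (u /\<^sub>R sqrt (1 - (norm u)\<^sup>2)) < 0 \<longleftrightarrow> hyperbola_form u + 5 * (norm u)\<^sup>2 < 5"
    "hyperbola_fn (u /\<^sub>R sqrt (1 - (norm u)\<^sup>2)) = 0 \<longleftrightarrow> hyperbola_form u + 5 * (norm u)\<^sup>2 = 5"
    using pos unfolding eq by (auto simp: field_simps)
qed

lemma to_disk_central_region:
  "to_disk ` central_region = {u. norm u < 1 \<and> u \<noteq> 0 \<and> hyperbola_form u + 5 * (norm u)\<^sup>2 < 5}"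
proof -
  have R: "central_region = {p. hyperbola_fn p < 0 \<and> p \<noteq> 0}" by (auto simp: central_region_def)
  have "sqrt (1 - (norm u)\<^sup>2) \<noteq> 0" if "norm u < 1" for u :: plane
  proof -
    have "(norm u)\<^sup>2 < 1" using that by (simp add: abs_square_less_1)
    then show ?thesis by simp
  qed
  then show ?thesis
    unfolding R to_disk_image using hyperbola_fn_preimage_iff(1) by (intro Collect_cong) auto
qed

lemma to_disk_hyperbola:
  "to_disk ` zero_locus hyperbola_fn = {u. norm u < 1 \<and> hyperbola_form u + 5 * (norm u)\<^sup>2 = 5}"
  unfolding zero_locus_def to_disk_image using hyperbola_fn_preimage_iff(2) by (intro Collect_cong) blast

text \<open>Each nonzero point \<open>u\<close> of the right-hand side is the limit, as \<open>s\<close> tends to \<open>1\<close>, of points \<open>s u\<close> at which both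
  inequalities are strict. The limit \<open>s = 0\<close> gives the origin.\<close>

lemma closure_to_disk_central_region:
  "closure (to_disk ` central_region) = {u. norm u \<le> 1 \<and> hyperbola_form u + 5 * (norm u)\<^sup>2 \<le> 5}"
    (is "_ = ?W")
proof
  have "closed ?W"
    by (intro closed_Collect_conj closed_Collect_le continuous_intros continuous_on_hyperbola_form)
  then show "closure (to_disk ` central_region) \<subseteq> ?W"
    by (intro closure_minimal) (auto simp: to_disk_central_region)
  have seg: "s *\<^sub>R u \<in> closure (to_disk ` central_region)" if u: "u \<in> ?W" "u \<noteq> 0" and s: "s \<in> {0..1}" for u s
  proof -
    have "s *\<^sub>R u \<in> to_disk ` central_region" if s: "s \<in> {0<..<1}" for s
    proof -
      have s2: "0 < s\<^sup>2" "s\<^sup>2 < 1" using s by (auto simp: abs_square_less_1)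
      have "s * norm u \<le> s * 1" using u s by (intro mult_left_mono) auto
      then have "s * norm u < 1" by (rule le_less_trans) (use s in auto)
      moreover have "s\<^sup>2 * (hyperbola_form u + 5 * (norm u)\<^sup>2) < 5"
      proof (cases "hyperbola_form u + 5 * (norm u)\<^sup>2 \<le> 0")
        case True
        then have "s\<^sup>2 * (hyperbola_form u + 5 * (norm u)\<^sup>2) \<le> 0" by (simp add: mult_nonneg_nonpos)
        then show ?thesis by simp
      next
        case False
        then have "s\<^sup>2 * (hyperbola_form u + 5 * (norm u)\<^sup>2) < 1 * (hyperbola_form u + 5 * (norm u)\<^sup>2)"
          using s2 by (intro mult_strict_right_mono) auto
        then show ?thesis using u by simp
      qed
      ultimately show ?thesis
        using s u by (simp add: to_disk_central_region hyperbola_form_scaleR power_mult_distrib algebra_simps)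
    qed
    then have "(\<lambda>s. s *\<^sub>R u) ` closure {0<..<1::real} \<subseteq> closure (to_disk ` central_region)"
      using closure_subset by (intro image_closure_subset continuous_intros) blast+
    then have "\<forall>s\<in>{0..1}. s *\<^sub>R u \<in> closure (to_disk ` central_region)"
      by (simp add: image_subset_iff)
    then show ?thesis using s by blast
  qed
  have W0: "(1 / 2, 0) \<in> ?W" by (simp add: hyperbola_form_def power2_eq_square)
  show "?W \<subseteq> closure (to_disk ` central_region)"
  proof
    fix u assume u: "u \<in> ?W"
    show "u \<in> closure (to_disk ` central_region)"
    proof (cases "u = 0")
      case True
      then show ?thesis using seg[OF W0, of 0] by (simp add: zero_prod_def)
    next
      case False
      then show ?thesis using seg[OF u False, of 1] by simp
    qed
  qed
qed

lemma equator_iff: "(x, y) \<in> equator \<longleftrightarrow> x\<^sup>2 + y\<^sup>2 = 1"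
  by (simp add: equator_def norm_Pair)

text \<open>The quarter circle is parametrized by \<open>t = (2 x - y) / sqrt 5\<close>, the distance to the asymptote of slope \<open>2\<close>; the
  distance to the other asymptote is then \<open>sqrt (1 - t\<^sup>2)\<close>.\<close>

lemma quarter_circle_arc:
  "\<exists>g. arc g \<and> path_image g = {p \<in> equator. 0 \<le> fst p + 2 * snd p \<and> snd p \<le> 2 * fst p}"
proof -
  define g :: "real \<Rightarrow> plane" where
    "g t = ((sqrt (1 - t\<^sup>2) + 2 * t) / sqrt 5, (2 * sqrt (1 - t\<^sup>2) - t) / sqrt 5)" for t
  have "arc g"
    unfolding arc_def path_def
  proof
    show "continuous_on {0..1} g" unfolding g_def by (intro continuous_intros) auto
    show "inj_on g {0..1}"
    proof (rule inj_on_inverseI)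
      fix t :: real
      have "snd (g t) - 2 * fst (g t) = - 5 * t / sqrt 5" by (simp add: g_def field_simps)
      then show "(2 * fst (g t) - snd (g t)) * sqrt 5 / 5 = t" by (simp add: field_simps)
    qed
  qed
  moreover have "path_image g = {p \<in> equator. 0 \<le> fst p + 2 * snd p \<and> snd p \<le> 2 * fst p}"
    unfolding path_image_def
  proof (intro equalityI subsetI)
    fix p assume "p \<in> g ` {0..1}"
    then obtain t where t: "0 \<le> t" "t \<le> 1" "p = g t" by auto
    have "(sqrt (1 - t\<^sup>2))\<^sup>2 = 1 - t\<^sup>2" using t by (simp add: power_le_one)
    then have "(fst p)\<^sup>2 + (snd p)\<^sup>2 = 1"
      by (simp add: t g_def power_divide power2_sum power2_diff field_simps)
    moreover have "0 \<le> fst p + 2 * snd p" "snd p \<le> 2 * fst p"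
      using t by (auto simp: g_def field_simps power_le_one)
    ultimately show "p \<in> {p \<in> equator. 0 \<le> fst p + 2 * snd p \<and> snd p \<le> 2 * fst p}"
      by (cases p) (simp add: equator_iff)
  next
    fix p assume p: "p \<in> {p \<in> equator. 0 \<le> fst p + 2 * snd p \<and> snd p \<le> 2 * fst p}"
    obtain x y where xy: "p = (x, y)" by (cases p)
    have e: "x\<^sup>2 + y\<^sup>2 = 1" "0 \<le> x + 2 * y" "y \<le> 2 * x" using p by (auto simp: xy equator_iff)
    define t where "t = (2 * x - y) / sqrt 5"
    have t2: "1 - t\<^sup>2 = ((x + 2 * y) / sqrt 5)\<^sup>2"
      using e(1) by (simp add: t_def power_divide power2_sum power2_diff field_simps)
    then have "sqrt (1 - t\<^sup>2) = (x + 2 * y) / sqrt 5" using e by simp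
    then have "g t = p" by (simp add: g_def xy t_def field_simps)
    moreover have "0 \<le> t" using e by (simp add: t_def)
    moreover have "t\<^sup>2 \<le> 1" using t2 by (metis diff_ge_0_iff_ge zero_le_power2)
    then have "t \<le> 1" using \<open>0 \<le> t\<close> by (simp add: abs_square_le_1)
    ultimately show "p \<in> g ` {0..1}" by force
  qed
  ultimately show ?thesis by blast
qed

text \<open>The complement of the region in the disk is closed, so the frontier consists of the points of the closure that are not
  in the region: the origin, the hyperbola, and the directions where \<open>hyperbola_form\<close> is at most \<open>0\<close>.\<close>

lemma frontier_to_disk_central_region:
  "\<exists>\<A>. finite \<A> \<and> \<A> \<noteq> {} \<and>
      (\<forall>A\<in>\<A>. \<exists>g. arc g \<and> path_image g \<subseteq> equator \<and> A = path_image g) \<and>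
      top_of_set poincare_disk frontier_of (to_disk ` central_region) =
        {0} \<union> to_disk ` zero_locus hyperbola_fn \<union> \<Union>\<A>"
proof -
  let ?S = "to_disk ` central_region"
  define A where "A = {p \<in> equator. 0 \<le> fst p + 2 * snd p \<and> snd p \<le> 2 * fst p}"
  define B where "B = uminus ` A"
  obtain g where g: "arc g" "path_image g = A" using quarter_circle_arc unfolding A_def by blast
  have "arc (uminus \<circ> g)"
    using g(1) by (auto simp: arc_def path_def inj_on_def intro!: continuous_on_compose continuous_intros)
  moreover have "path_image (uminus \<circ> g) = B" using g(2) by (simp add: path_image_compose B_def)
  ultimately obtain g' where g': "arc g'" "path_image g' = B" by blast
  have arcs: "\<Union>{A, B} = {u. norm u = 1 \<and> hyperbola_form u \<le> 0}"
  proof -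
    have "u \<in> B \<longleftrightarrow> u \<in> equator \<and> fst u + 2 * snd u \<le> 0 \<and> 2 * fst u \<le> snd u" for u
    proof -
      have "u \<in> B \<longleftrightarrow> - u \<in> A" unfolding B_def by (metis (no_types, lifting) imageE image_eqI minus_minus)
      then show ?thesis by (auto simp: A_def equator_def)
    qed
    then show ?thesis
      by (auto simp: A_def equator_def hyperbola_form_def mult_le_0_iff zero_le_mult_iff split: prod.splits)
  qed
  have W: "closure ?S = {u. norm u \<le> 1 \<and> hyperbola_form u + 5 * (norm u)\<^sup>2 \<le> 5}"
    by (rule closure_to_disk_central_region)
  have inner: "norm u < 1" if "hyperbola_form u + 5 * (norm u)\<^sup>2 = 5" "\<not> hyperbola_form u \<le> 0" for u
  proof -
    have "(norm u)\<^sup>2 < 1" using that by linarith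
    then show ?thesis by (simp add: abs_square_less_1)
  qed
  have h0: "hyperbola_form 0 = 0" by (simp add: hyperbola_form_def zero_prod_def)
  have sub: "?S \<subseteq> cball 0 1" by (auto simp: to_disk_central_region)
  have compl: "cball 0 1 - ?S = cball 0 1 \<inter> (sphere 0 1 \<union> {0} \<union> {u. 5 \<le> hyperbola_form u + 5 * (norm u)\<^sup>2})"
    by (auto simp: to_disk_central_region)
  have "closed (cball 0 1 - ?S)"
    unfolding compl
    by (intro closed_Int closed_Un closed_cball closed_sphere closed_singleton closed_Collect_le
        continuous_intros continuous_on_hyperbola_form)
  then have "top_of_set poincare_disk frontier_of ?S = closure ?S \<inter> (cball 0 1 - ?S)"
    using sub closure_minimal[OF sub closed_cball]
    by (auto simp: frontier_of_closures closure_of_subtopology poincare_disk_eq Int_absorb1 closure_closed)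
  also have "\<dots> = {0} \<union> to_disk ` zero_locus hyperbola_fn \<union> \<Union>{A, B}"
    unfolding arcs W compl to_disk_hyperbola using h0 inner by auto
  finally have "top_of_set poincare_disk frontier_of ?S = {0} \<union> to_disk ` zero_locus hyperbola_fn \<union> \<Union>{A, B}" .
  moreover have "A \<subseteq> equator" "B \<subseteq> equator" by (auto simp: A_def B_def equator_def norm_Pair)
  then have "\<exists>h. arc h \<and> path_image h \<subseteq> equator \<and> A = path_image h"
    "\<exists>h. arc h \<and> path_image h \<subseteq> equator \<and> B = path_image h"
    using g g' by blast+
  then have "\<forall>C\<in>{A, B}. \<exists>h. arc h \<and> path_image h \<subseteq> equator \<and> C = path_image h" by simp
  moreover have "finite {A, B}" "{A, B} \<noteq> {}" by simp_all
  ultimately show ?thesis by (intro exI[of _ "{A, B}"] conjI)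
qed

section \<open>Critical points at infinity\<close>

text \<open>On the equator the field vanishes only if \<open>x = 0\<close> or the cubic \<open>- x\<^sup>3 + \<delta> x\<^sup>2 y + y\<^sup>3\<close> does. The vertical
  direction does not lie in the closure of the region, and slopes in \<open>[- 1 / 2, 0]\<close> are no roots of \<open>m\<^sup>3 + \<delta> m - 1\<close> for
  \<open>\<delta> \<ge> - 53 / 25\<close>. The last conclusion, a consequence of \<open>m (m\<^sup>2 + \<delta>) = 1\<close>, says that the cubic changes sign at
  \<open>m\<close> in the repelling direction.\<close>

lemma critical_at_infinity_in_region:
  assumes \<delta>: "- (53 / 25) \<le> \<delta>" and crit: "critical_at_infinity 3 (system \<delta>) (x, y)"
    and cl: "(x, y) \<in> closure (to_disk ` central_region)"
  shows "x\<^sup>2 + y\<^sup>2 = 1" "0 < x * y" "- (x ^ 3) + \<delta> * x\<^sup>2 * y + y ^ 3 = 0" "0 < (y / x)\<^sup>2 + \<delta>"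
proof -
  define Q where "Q = - (x ^ 3) + \<delta> * x\<^sup>2 * y + y ^ 3"
  show 1: "x\<^sup>2 + y\<^sup>2 = 1" using crit by (simp add: critical_at_infinity_def equator_iff)
  have "norm (x, y) = 1" using 1 by (simp add: norm_Pair)
  then have form: "(x + 2 * y) * (y - 2 * x) \<le> 0"
    using cl unfolding closure_to_disk_central_region by (simp add: hyperbola_form_def algebra_simps)
  have x: "x \<noteq> 0"
  proof
    assume "x = 0"
    then show False using 1 form by (auto simp: power2_eq_square)
  qed
  have "Q - y * (y * Q) = 0"
    using crit by (simp add: critical_at_infinity_def compactified_system radial_speed_def Q_def zero_prod_def)
  moreover have "x\<^sup>2 * Q = Q - y * (y * Q)" using 1 by algebra
  ultimately have "x\<^sup>2 * Q = 0" by metis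
  then have "Q = 0" using x by simp
  then show Q: "- (x ^ 3) + \<delta> * x\<^sup>2 * y + y ^ 3 = 0" unfolding Q_def .
  define m where "m = y / x"
  have y: "y = m * x" using x by (simp add: m_def)
  have "x ^ 3 * (m ^ 3 + \<delta> * m - 1) = 0" using Q unfolding y by (simp add: algebra_simps power2_eq_square power3_eq_cube)
  then have m: "m ^ 3 + \<delta> * m - 1 = 0" using x by simp
  have "(x + 2 * y) * (y - 2 * x) = x\<^sup>2 * ((1 + 2 * m) * (m - 2))"
    unfolding y by (simp add: algebra_simps power2_eq_square)
  then have "(1 + 2 * m) * (m - 2) \<le> 0" using form x by (simp add: mult_le_0_iff)
  then have m_low: "- 1 / 2 \<le> m" by (auto simp: mult_le_0_iff)
  have m_pos: "0 < m"
  proof (rule ccontr)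
    assume "\<not> 0 < m"
    then have "\<delta> * m \<le> - (53 / 25) * m" using \<delta> by (intro mult_right_mono_neg) auto
    \<comment> \<open>\<open>m\<^sup>3\<close> lies below its tangent at \<open>m = - 1 / 2\<close>\<close>
    moreover have "0 \<le> (m + 1 / 2)\<^sup>2 * (1 - m)"
      using \<open>\<not> 0 < m\<close> by simp
    moreover have "(m + 1 / 2)\<^sup>2 * (1 - m) = 3 / 4 * m + 1 / 4 - m ^ 3"
      by (simp add: field_simps power2_eq_square power3_eq_cube)
    ultimately show False using m m_low by linarith
  qed
  moreover have "x * y = m * x\<^sup>2" by (simp add: y power2_eq_square)
  ultimately show "0 < x * y" using x by simp
  have "m * (m\<^sup>2 + \<delta>) = 1" using m by (simp add: algebra_simps power2_eq_square power3_eq_cube)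
  then show "0 < (y / x)\<^sup>2 + \<delta>"
    using m_pos by (metis m_def zero_less_mult_pos zero_less_one)
qed

lemma disk_proj_limit:
  assumes lim: "((\<lambda>t. disk_proj (\<gamma> t)) \<longlongrightarrow> (x, y)) F" and xy: "x\<^sup>2 + y\<^sup>2 = 1" "0 < x * y"
    and hemi: "\<forall>\<^sub>F t in F. \<gamma> t \<in> hemisphere"
  shows "((\<lambda>t. fst (\<gamma> t)) \<longlongrightarrow> x) F" "((\<lambda>t. fst (snd (\<gamma> t))) \<longlongrightarrow> y) F"
    "((\<lambda>t. snd (snd (\<gamma> t))) \<longlongrightarrow> 0) F"
    "\<forall>\<^sub>F t in F. 0 < fst (\<gamma> t) * fst (snd (\<gamma> t))" "\<forall>\<^sub>F t in F. 0 < fst (\<gamma> t) * x"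
proof -
  show X: "((\<lambda>t. fst (\<gamma> t)) \<longlongrightarrow> x) F" and Y: "((\<lambda>t. fst (snd (\<gamma> t))) \<longlongrightarrow> y) F"
    using tendsto_fst[OF lim] tendsto_snd[OF lim] by (simp_all add: disk_proj_def case_prod_unfold)
  have "sqrt (1 - x\<^sup>2 - y\<^sup>2) = 0" using xy by simp
  moreover have "((\<lambda>t. sqrt (1 - (fst (\<gamma> t))\<^sup>2 - (fst (snd (\<gamma> t)))\<^sup>2)) \<longlongrightarrow> sqrt (1 - x\<^sup>2 - y\<^sup>2)) F"
    by (intro tendsto_intros X Y)
  ultimately have sqrt_lim: "((\<lambda>t. sqrt (1 - (fst (\<gamma> t))\<^sup>2 - (fst (snd (\<gamma> t)))\<^sup>2)) \<longlongrightarrow> 0) F"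
    by (simp only:)
  have "\<forall>\<^sub>F t in F. sqrt (1 - (fst (\<gamma> t))\<^sup>2 - (fst (snd (\<gamma> t)))\<^sup>2) = snd (snd (\<gamma> t))"
    using hemi
  proof eventually_elim
    case (elim t)
    obtain X Y Z where XYZ: "\<gamma> t = (X, Y, Z)" by (cases "\<gamma> t") auto
    then have "1 - X\<^sup>2 - Y\<^sup>2 = Z\<^sup>2" "0 \<le> Z" using elim by (auto simp: hemisphere_def)
    then show ?case by (simp add: XYZ)
  qed
  then show "((\<lambda>t. snd (snd (\<gamma> t))) \<longlongrightarrow> 0) F"
    by (rule Lim_transform_eventually[OF sqrt_lim])
  show "\<forall>\<^sub>F t in F. 0 < fst (\<gamma> t) * fst (snd (\<gamma> t))"
    by (rule order_tendstoD(1)[OF tendsto_mult[OF X Y] xy(2)])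
  have "0 < x * x" using xy by (auto simp: zero_less_mult_iff)
  then show "\<forall>\<^sub>F t in F. 0 < fst (\<gamma> t) * x"
    by (rule order_tendstoD(1)[OF tendsto_mult[OF X tendsto_const]])
qed

text \<open>For \<open>z = Z / X\<close> the compactified system gives \<open>z' = - (Y / X\<^sup>2) Z\<^sup>3\<close>, so \<open>z\<^sup>2\<close> decreases wherever \<open>X Y > 0\<close>.
  An orbit off the equator that converged to the point in backward time would have \<open>z\<^sup>2\<close> growing backwards from a
  positive value, yet tending to \<open>0\<close>.\<close>

lemma not_disk_source:
  assumes xy: "x\<^sup>2 + y\<^sup>2 = 1" "0 < x * y"
  shows "\<not> disk_source 3 (system \<delta>) (x, y)"
proof
  let ?F = "compactified_field 3 (system \<delta>)"
  assume "disk_source 3 (system \<delta>) (x, y)"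
  then obtain U where U: "open U" "(x, y) \<in> U"
    "\<And>\<phi>. disk_orbit 3 (system \<delta>) \<phi> {..0} \<Longrightarrow> \<phi> 0 \<in> U \<Longrightarrow> (\<phi> \<longlongrightarrow> (x, y)) at_bot"
    unfolding disk_source_def by blast
  \<comment> \<open>the orbit starts at height \<open>e > 0\<close> above the equator, over a point of \<open>U\<close>\<close>
  have "((\<lambda>e. sqrt (1 - e\<^sup>2) *\<^sub>R (x, y)) \<longlongrightarrow> sqrt (1 - 0\<^sup>2) *\<^sub>R (x, y)) (at_right (0::real))"
    by (intro tendsto_intros)
  then have "\<forall>\<^sub>F e in at_right 0. sqrt (1 - e\<^sup>2) *\<^sub>R (x, y) \<in> U"
    using U by (intro topological_tendstoD) auto
  moreover have "\<forall>\<^sub>F e in at_right (0::real). 0 < e \<and> e < 1"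
    by (auto simp: eventually_at_right_field intro: exI[of _ 1])
  ultimately have "\<forall>\<^sub>F e in at_right 0. sqrt (1 - e\<^sup>2) *\<^sub>R (x, y) \<in> U \<and> 0 < e \<and> e < 1"
    by eventually_elim auto
  then obtain e where e: "sqrt (1 - e\<^sup>2) *\<^sub>R (x, y) \<in> U" "0 < e" "e < 1"
    using eventually_happens' trivial_limit_at_right_real by blast
  define c where "c = sqrt (1 - e\<^sup>2)"
  have "c\<^sup>2 = 1 - e\<^sup>2" using e by (simp add: c_def abs_square_le_1)
  moreover have "(c * x)\<^sup>2 + (c * y)\<^sup>2 = c\<^sup>2" using xy by algebra
  ultimately have "(c * x, c * y, e) \<in> hemisphere" using e by (simp add: hemisphere_def)
  then obtain \<gamma> where \<gamma>: "\<gamma> 0 = (c * x, c * y, e)" "solves_on ?F \<gamma> {..0}" "\<gamma> ` {..0} \<subseteq> hemisphere"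
    using hemisphere_orbits_exist(2) by blast
  have lim: "((\<lambda>t. disk_proj (\<gamma> t)) \<longlongrightarrow> (x, y)) at_bot"
    by (rule U(3)) (use \<gamma> e in \<open>auto simp: disk_orbit_def disk_proj_def c_def\<close>)
  have hemi: "\<forall>\<^sub>F t in at_bot. \<gamma> t \<in> hemisphere"
    using \<gamma>(3) by (auto simp: eventually_at_bot_linorder)
  note near = disk_proj_limit[OF lim xy hemi]
  define w where "w t = (snd (snd (\<gamma> t)) / fst (\<gamma> t))\<^sup>2" for t
  obtain T where T: "T \<le> 0" "\<And>t. t \<le> T \<Longrightarrow> 0 < fst (\<gamma> t) * fst (snd (\<gamma> t))"
    using near(4) unfolding eventually_at_bot_linorder
    by (metis linorder_le_cases order_trans)
  have unit: "\<And>t. t \<in> {..0} \<Longrightarrow> norm (\<gamma> t) = 1" using \<gamma>(3) by (auto simp: hemisphere_iff)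
  have "snd (snd (\<gamma> T)) \<noteq> 0"
    using equator_invariant[OF \<gamma>(2), of T 0, OF _ _ _ unit] T(1) \<gamma>(1) e by (auto simp: is_interval_ic)
  then have wT: "0 < w T" using T(2)[of T] by (auto simp: w_def)
  let ?w' = "\<lambda>s. 2 * (snd (snd (\<gamma> s)) / fst (\<gamma> s)) *
      (snd (snd (?F (\<gamma> s))) / fst (\<gamma> s) - snd (snd (\<gamma> s)) * fst (?F (\<gamma> s)) / (fst (\<gamma> s))\<^sup>2)"
  have decr: "w T \<le> w t" if t: "t \<le> T" for t
  proof (rule nonpos_derivative_within_imp_le[where f' = ?w', OF t])
    fix s assume s: "s \<in> {t..T}"
    obtain X Y Z where XYZ: "\<gamma> s = (X, Y, Z)" by (cases "\<gamma> s") auto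
    have XY: "0 < X * Y" using T(2)[of s] s by (simp add: XYZ)
    then have X: "X \<noteq> 0" by auto
    have d: "((\<lambda>p. (snd (snd p) / fst p)\<^sup>2) has_derivative
        (\<lambda>h. 2 * (Z / X) * (snd (snd h) / X - Z * fst h / X\<^sup>2))) (at (\<gamma> s))"
      by (auto intro!: derivative_eq_intros simp: XYZ X fun_eq_iff field_simps power2_eq_square)
    have "solves_on ?F \<gamma> {t..T}" using T(1) by (intro solves_on_subset[OF \<gamma>(2)]) auto
    from solves_on_has_real_derivative[OF this s d]
    show "(w has_real_derivative ?w' s) (at s within {t..T})"
      by (simp add: w_def[abs_def] XYZ)
    have "?w' s = - (2 * Z ^ 4 * (X * Y) / X ^ 4)"
      using X unfolding XYZ compactified_system by (simp add: field_simps power2_eq_square power4_eq_xxxx)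
    also have "\<dots> \<le> 0" using XY by simp
    finally show "?w' s \<le> 0" .
  qed
  have "x \<noteq> 0" using xy by auto
  then have "(w \<longlongrightarrow> (0 / x)\<^sup>2) at_bot"
    unfolding w_def[abs_def] by (intro tendsto_intros near)
  then have "w T \<le> (0 / x)\<^sup>2"
    by (rule tendsto_lowerbound) (use decr in \<open>auto simp: eventually_at_bot_linorder\<close>)
  then show False using wT by simp
qed

text \<open>On the equator the slope \<open>n = Y / X\<close> satisfies \<open>n' = X\<^sup>2 (n\<^sup>3 + \<delta> n - 1)\<close>, so \<open>(n - m)\<^sup>2\<close> does not decrease
  while \<open>n > 0\<close>. An orbit on the equator that converges to the point must therefore reach it in finite time,
  which uniqueness of solutions forbids.\<close>

lemma not_disk_sink:
  assumes xy: "x\<^sup>2 + y\<^sup>2 = 1" "0 < x * y" and Q: "- (x ^ 3) + \<delta> * x\<^sup>2 * y + y ^ 3 = 0"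
    and simple: "0 < (y / x)\<^sup>2 + \<delta>"
  shows "\<not> disk_sink 3 (system \<delta>) (x, y)"
proof
  let ?F = "compactified_field 3 (system \<delta>)"
  assume "disk_sink 3 (system \<delta>) (x, y)"
  then obtain U where U: "open U" "(x, y) \<in> U"
    "\<And>\<phi>. disk_orbit 3 (system \<delta>) \<phi> {0..} \<Longrightarrow> \<phi> 0 \<in> U \<Longrightarrow> (\<phi> \<longlongrightarrow> (x, y)) at_top"
    unfolding disk_sink_def by blast
  \<comment> \<open>the orbit starts on the equator, at \<open>(x, y)\<close> rotated by the angle with sine \<open>e\<close>\<close>
  have "((\<lambda>e. (sqrt (1 - e\<^sup>2) * x - e * y, sqrt (1 - e\<^sup>2) * y + e * x)) \<longlongrightarrow>
      (sqrt (1 - 0\<^sup>2) * x - 0 * y, sqrt (1 - 0\<^sup>2) * y + 0 * x)) (at_right (0::real))"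
    by (intro tendsto_intros)
  then have "\<forall>\<^sub>F e in at_right 0. (sqrt (1 - e\<^sup>2) * x - e * y, sqrt (1 - e\<^sup>2) * y + e * x) \<in> U"
    using U by (intro topological_tendstoD) auto
  moreover have "\<forall>\<^sub>F e in at_right (0::real). 0 < e \<and> e < 1"
    by (auto simp: eventually_at_right_field intro: exI[of _ 1])
  ultimately have "\<forall>\<^sub>F e in at_right 0. (sqrt (1 - e\<^sup>2) * x - e * y, sqrt (1 - e\<^sup>2) * y + e * x) \<in> U \<and> 0 < e \<and> e < 1"
    by eventually_elim auto
  then obtain e where e: "(sqrt (1 - e\<^sup>2) * x - e * y, sqrt (1 - e\<^sup>2) * y + e * x) \<in> U" "0 < e" "e < 1"
    using eventually_happens' trivial_limit_at_right_real by blast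
  define c where "c = sqrt (1 - e\<^sup>2)"
  have c: "c\<^sup>2 = 1 - e\<^sup>2" using e by (simp add: c_def abs_square_le_1)
  have "(c * x - e * y)\<^sup>2 + (c * y + e * x)\<^sup>2 = (c\<^sup>2 + e\<^sup>2) * (x\<^sup>2 + y\<^sup>2)" by algebra
  then have "(c * x - e * y, c * y + e * x, 0) \<in> hemisphere" using xy c by (simp add: hemisphere_def)
  then obtain \<gamma> where \<gamma>: "\<gamma> 0 = (c * x - e * y, c * y + e * x, 0)" "solves_on ?F \<gamma> {0..}" "\<gamma> ` {0..} \<subseteq> hemisphere"
    using hemisphere_orbits_exist(1) by blast
  have lim: "((\<lambda>t. disk_proj (\<gamma> t)) \<longlongrightarrow> (x, y)) at_top"
    by (rule U(3)) (use \<gamma> e in \<open>auto simp: disk_orbit_def disk_proj_def c_def\<close>)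
  have hemi: "\<forall>\<^sub>F t in at_top. \<gamma> t \<in> hemisphere"
    using \<gamma>(3) by (auto simp: eventually_at_top_linorder)
  note near = disk_proj_limit[OF lim xy hemi]
  have unit: "\<And>t. t \<in> {0..} \<Longrightarrow> norm (\<gamma> t) = 1" using \<gamma>(3) by (auto simp: hemisphere_iff)
  have Z0: "snd (snd (\<gamma> t)) = 0" if "0 \<le> t" for t
    by (rule equator_invariant[OF \<gamma>(2), of 0]) (use that unit \<gamma>(1) in \<open>auto simp: is_interval_ci\<close>)
  obtain T where T: "0 \<le> T" "\<And>t. T \<le> t \<Longrightarrow> 0 < fst (\<gamma> t) * fst (snd (\<gamma> t))" "\<And>t. T \<le> t \<Longrightarrow> 0 < fst (\<gamma> t) * x"
    using eventually_conj[OF eventually_ge_at_top[of 0] eventually_conj[OF near(4,5)]]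
    unfolding eventually_at_top_linorder by (metis order_refl)
  have x0: "x \<noteq> 0" using xy by auto
  define m where "m = y / x"
  have m: "0 < m" using xy(2) by (auto simp: m_def zero_less_divide_iff zero_less_mult_iff)
  have ym: "y = m * x" using x0 by (simp add: m_def)
  have "x ^ 3 * (m ^ 3 + \<delta> * m - 1) = 0"
    using Q unfolding ym by (simp add: algebra_simps power2_eq_square power3_eq_cube)
  then have root: "m ^ 3 + \<delta> * m = 1" using x0 by simp
  define w where "w t = (fst (snd (\<gamma> t)) / fst (\<gamma> t) - m)\<^sup>2" for t
  let ?w' = "\<lambda>s. 2 * (fst (snd (\<gamma> s)) / fst (\<gamma> s) - m) *
      (fst (snd (?F (\<gamma> s))) / fst (\<gamma> s) - fst (snd (\<gamma> s)) * fst (?F (\<gamma> s)) / (fst (\<gamma> s))\<^sup>2)"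
  have incr: "- w t \<le> - w T" if t: "T \<le> t" for t
  proof (rule nonpos_derivative_within_imp_le[where f' = "\<lambda>s. - ?w' s", OF t])
    fix s assume s: "s \<in> {T..t}"
    obtain X Y Z where XYZ: "\<gamma> s = (X, Y, Z)" by (cases "\<gamma> s") auto
    have Z: "Z = 0" using Z0[of s] s T(1) by (simp add: XYZ)
    have XY: "0 < X * Y" using T(2)[of s] s by (simp add: XYZ)
    then have X: "X \<noteq> 0" by auto
    have d: "((\<lambda>p. (fst (snd p) / fst p - m)\<^sup>2) has_derivative
        (\<lambda>h. 2 * (Y / X - m) * (fst (snd h) / X - Y * fst h / X\<^sup>2))) (at (\<gamma> s))"
      by (auto intro!: derivative_eq_intros simp: XYZ X fun_eq_iff field_simps power2_eq_square)
    have "solves_on ?F \<gamma> {T..t}" using T(1) by (intro solves_on_subset[OF \<gamma>(2)]) auto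
    from DERIV_minus[OF solves_on_has_real_derivative[OF this s d]]
    show "((\<lambda>t. - w t) has_real_derivative - ?w' s) (at s within {T..t})"
      by (simp add: w_def[abs_def] XYZ)
    define n where "n = Y / X"
    have n: "0 < n" "Y = n * X" using XY X by (auto simp: n_def zero_less_divide_iff zero_less_mult_iff)
    have "?w' s = 2 * X\<^sup>2 * ((n - m) * (n ^ 3 + \<delta> * n - 1))"
      using X unfolding XYZ compactified_system Z n(2)
      by (simp add: field_simps power2_eq_square power3_eq_cube)
    also have "n ^ 3 + \<delta> * n - 1 = (n - m) * (n\<^sup>2 + n * m + (m\<^sup>2 + \<delta>))"
      unfolding root[symmetric] by algebra
    also have "(n - m) * ((n - m) * (n\<^sup>2 + n * m + (m\<^sup>2 + \<delta>))) = (n - m)\<^sup>2 * (n\<^sup>2 + n * m + (m\<^sup>2 + \<delta>))"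
      by algebra
    finally have "?w' s = 2 * X\<^sup>2 * ((n - m)\<^sup>2 * (n\<^sup>2 + n * m + (m\<^sup>2 + \<delta>)))" .
    moreover have "0 < m\<^sup>2 + \<delta>" using simple by (simp add: m_def)
    then have "0 \<le> n\<^sup>2 + n * m + (m\<^sup>2 + \<delta>)"
      using mult_pos_pos[OF n(1) m] zero_le_power2[of n] by linarith
    ultimately show "- ?w' s \<le> 0" by simp
  qed
  have "(w \<longlongrightarrow> (y / x - m)\<^sup>2) at_top"
    unfolding w_def[abs_def] by (intro tendsto_intros near x0)
  then have "w T \<le> (y / x - m)\<^sup>2"
    by (rule tendsto_lowerbound) (use incr in \<open>auto simp: eventually_at_top_linorder\<close>)
  then have wT: "fst (snd (\<gamma> T)) / fst (\<gamma> T) = m" by (simp add: w_def m_def)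
  have \<gamma>T: "\<gamma> T = (x, y, 0)"
  proof -
    obtain X Y Z where XYZ: "\<gamma> T = (X, Y, Z)" by (cases "\<gamma> T") auto
    have Z: "Z = 0" using Z0[OF T(1)] by (simp add: XYZ)
    have Xx: "0 < X * x" using T(3)[of T] by (simp add: XYZ)
    then have Y: "Y = m * X" using wT by (auto simp: XYZ field_simps)
    have "X\<^sup>2 + Y\<^sup>2 = 1" using unit[of T] T(1) by (simp add: XYZ Z norm_Pair)
    then have "(1 + m\<^sup>2) * X\<^sup>2 = (1 + m\<^sup>2) * x\<^sup>2"
      using xy(1) unfolding Y ym by (simp add: algebra_simps power_mult_distrib)
    moreover have "1 + m\<^sup>2 \<noteq> 0" using m by (simp add: add_pos_nonneg less_imp_neq[symmetric])
    ultimately have "X\<^sup>2 = x\<^sup>2" by simp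
    then have "X = x" using Xx by (auto simp: power2_eq_iff mult_less_0_iff)
    then show ?thesis by (simp add: XYZ Z Y ym)
  qed
  obtain L where L: "L-lipschitz_on (cball 0 1) ?F" using lipschitz_compactified_system by blast
  have "?F (x, y, 0) = 0"
    using Q by (simp add: compactified_system radial_speed_def zero_prod_def)
  then have const: "solves_on ?F (\<lambda>t. (x, y, 0)) {0..}" by (simp add: solves_on_def)
  have "\<gamma> 0 = (x, y, 0)"
    by (rule lipschitz_solutions_unique[OF L _ _ _ \<gamma>(2) _ const, of T])
      (use T(1) \<gamma>T unit xy(1) in \<open>auto simp: is_interval_ci norm_Pair\<close>)
  then have "c * x - e * y = x" "c * y + e * x = y" using \<gamma>(1) by auto
  moreover have "e * (x\<^sup>2 + y\<^sup>2) = x * (c * y + e * x) - y * (c * x - e * y)"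
    by (simp add: algebra_simps power2_eq_square)
  ultimately have "e * (x\<^sup>2 + y\<^sup>2) = 0" by simp
  then show False using xy e by simp
qed

section \<open>The extended Poincare-Bendixson region\<close>

lemma critical_delta_le: "3 * root 3 (- 9 + 6 * sqrt 3) / root 3 4 \<le> 53 / 25"
proof -
  have "sqrt 3 \<le> 17321 / 10000" by (rule real_le_lsqrt) (auto simp: power2_eq_square)
  then have "(- 9 + 6 * sqrt 3) / 4 \<le> (53 / 75) ^ 3" by (simp add: power3_eq_cube)
  then have "root 3 ((- 9 + 6 * sqrt 3) / 4) \<le> root 3 ((53 / 75) ^ 3)" by simp
  also have "\<dots> = 53 / 75" by (rule real_root_power_cancel) auto
  finally have "3 * root 3 ((- 9 + 6 * sqrt 3) / 4) \<le> 53 / 25" by simp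
  then show ?thesis by (simp only: real_root_divide times_divide_eq_right)
qed

theorem lemma6:
  fixes \<delta> :: real
  assumes "0 > \<delta>"
    and "\<delta> > - (3 * root 3 (- 9 + 6 * sqrt 3) / root 3 4)"
  shows "\<exists>f R. poincare_bendixson_region 3 (system \<delta>) f R"
proof -
  have \<delta>: "- (53 / 25) \<le> \<delta>" using assms(2) critical_delta_le by linarith
  have "\<not> disk_sink 3 (system \<delta>) p \<and> \<not> disk_source 3 (system \<delta>) p"
    if "critical_at_infinity 3 (system \<delta>) p" "p \<in> closure (to_disk ` central_region)" for p
  proof -
    obtain x y where xy: "p = (x, y)" by (cases p)
    note crit = critical_at_infinity_in_region[OF \<delta> that[unfolded xy]]
    show ?thesis
      unfolding xy using not_disk_sink[OF crit] not_disk_source[OF crit(1,2)] by blast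
  qed
  moreover have "system \<delta> p \<noteq> 0" if "p \<in> central_region" for p
    using that by (cases p) (auto simp: central_region_def system_def zero_prod_def)
  moreover have "central_region = connected_component_set (- zero_locus hyperbola_fn) 0 - {0}"
    by (simp add: central_region_def component_of_origin)
  moreover have "0 \<notin> zero_locus hyperbola_fn" by (simp add: zero_locus_def hyperbola_fn_def hyperbola_form_def zero_prod_def)
  ultimately have "poincare_bendixson_region 3 (system \<delta>) hyperbola_fn central_region"
    unfolding poincare_bendixson_region_def
    using origin_asymptotically_stable[OF assms(1)] hyperbola_poly_hyperbola_fn transversal_hyperbola_fn[OF \<delta>]
      frontier_to_disk_central_region flow_exits_central_region[OF \<delta>]
    by blast
  then show ?thesis by blast
qed

end
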